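(* Let $\mathcal{X}$ be a compact subset of $\mathbb{R}^m$, $\sigma_0>0$, and $k(x,y)=\exp(-\|x-y\|^2/\sigma_0^2)$. Let $\lambda\neq0$ be a simple eigenvalue of $T$ with eigenfunction $u\in C(\mathcal{X})$, $\|u\|_\infty=1$, let $(\lambda_n)_n$ be a sequence of eigenvalues of $\widehat{T_n}$ with $\lambda_n\to\lambda$ (almost surely), and let $u_n$ be corresponding eigenfunctions, $\widehat{T_n}u_n=\lambda_nu_n$, $\|u_n\|_\infty=1$. Then there are signs $a_n\in\{+1,-1\}$ such that $\|a_nu_n-u\|_\infty=\mathcal{O}(1/\sqrt n)$ in probability; that is, for every $\delta\in(0,1)$ there exist $C_\delta>0$ and $n_\delta\in\mathbb{N}$ such that for all $n\ge n_\delta$, with probability at least $1-\delta$, $\|a_nu_n-u\|_\infty\le C_\delta/\sqrt n$.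
   Context: $P$ is a Borel probability measure on $\mathcal{X}$ with support $\mathcal{X}$; $X_1,X_2,\dots$ are i.i.d. with law $P$; $P_n=\frac1n\sum_{i=1}^n\delta_{X_i}$. $d_n(x)=\int k(x,y)\,dP_n(y)$, $d(x)=\int k(x,y)\,dP(y)$, $h_n(x,y)=k(x,y)/\sqrt{d_n(x)d_n(y)}$, $h(x,y)=k(x,y)/\sqrt{d(x)d(y)}$. Operators on $(C(\mathcal{X}),\|\cdot\|_\infty)$: $\widehat{T_n}f(x)=\int h_n(x,y)f(y)\,dP_n(y)$, $Tf(x)=\int h(x,y)f(y)\,dP(y)$. Simple means algebraic multiplicity 1. *)

theory Defs
  imports "HOL-Probability.Probability" "HOL-Library.Function_Algebras"
begin

text \<open>
  Pointwise addition of functions comes from \<^theory>\<open>HOL-Library.Function_Algebras\<close>; with pointwise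
  scaling by reals the real-valued functions on a type form a vector space, which supplies the
  notion of dimension \<open>fun_vs.dim\<close>.
\<close>

global_interpretation fun_vs: vector_space "\<lambda>(c::real) (f :: 'a \<Rightarrow> real) x. c * f x"
  by unfold_locales (auto simp: fun_eq_iff algebra_simps)

text \<open>
  \<open>C(S)\<close>: a continuous function on \<open>S\<close> is represented by its extension by zero, so that
  equality of functions on \<open>S\<close> is equality in the logic. (No continuity of the extension
  outside \<open>S\<close> is implied.)
\<close>

definition cont_funs :: "'a::topological_space set \<Rightarrow> ('a \<Rightarrow> real) set" where
  "cont_funs S = {f. continuous_on S f \<and> (\<forall>x. x \<notin> S \<longrightarrow> f x = 0)}"

lemma subspace_cont_funs: "fun_vs.subspace (cont_funs S)"
  unfolding fun_vs.subspace_def cont_funs_def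
  by (auto simp: zero_fun_def plus_fun_def intro!: continuous_intros)

definition sup_norm :: "'a set \<Rightarrow> ('a \<Rightarrow> real) \<Rightarrow> real" where
  "sup_norm S f = (SUP x\<in>S. \<bar>f x\<bar>)"

definition measure_support :: "'a::topological_space measure \<Rightarrow> 'a set" where
  "measure_support P =
     {x \<in> space P. \<forall>U. open U \<and> x \<in> U \<longrightarrow> emeasure P (U \<inter> space P) > 0}"

definition gauss_kernel :: "real \<Rightarrow> 'a::real_normed_vector \<Rightarrow> 'a \<Rightarrow> real" where
  "gauss_kernel \<sigma> x y = exp (- (norm (x - y))\<^sup>2 / \<sigma>\<^sup>2)"

definition empirical_measure :: "'a measure \<Rightarrow> (nat \<Rightarrow> 'a) \<Rightarrow> nat \<Rightarrow> 'a measure" where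
  "empirical_measure P x n =
     measure_of (space P) (sets P)
       (\<lambda>A. ennreal (1 / real n) * (\<Sum>i=1..n. emeasure (return P (x i)) A))"

lemma space_empirical_measure [simp]: "space (empirical_measure P x n) = space P"
  and sets_empirical_measure [simp]: "sets (empirical_measure P x n) = sets P"
  by (simp_all add: empirical_measure_def)

lemma emeasure_empirical_measure:
  assumes "A \<in> sets P"
  shows "emeasure (empirical_measure P x n) A =
           ennreal (1 / real n) * (\<Sum>i=1..n. emeasure (return P (x i)) A)"
proof (rule emeasure_measure_of[OF empirical_measure_def])
  let ?f = "\<lambda>A. ennreal (1 / real n) * (\<Sum>i=1..n. emeasure (return P (x i)) A)"
  show "sets P \<subseteq> Pow (space P)" by (rule sets.space_closed)
  show "A \<in> sets (empirical_measure P x n)" using assms by simp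
  show "positive (sets (empirical_measure P x n)) ?f"
    by (simp add: positive_def)
  show "countably_additive (sets (empirical_measure P x n)) ?f"
  proof (rule countably_additiveI)
    fix A :: "nat \<Rightarrow> 'a set"
    assume A: "range A \<subseteq> sets (empirical_measure P x n)" "disjoint_family A"
    have "(\<Sum>j. emeasure (return P (x i)) (A j)) = emeasure (return P (x i)) (\<Union>j. A j)" for i
      using A by (intro suminf_emeasure) auto
    then show "(\<Sum>j. ?f (A j)) = ?f (\<Union>j. A j)"
      by (simp add: suminf_sum)
  qed
qed

text \<open>
  The operators for the law and for the empirical measure are the same construction applied to two
  measures \<open>Q\<close> on the same space: \<open>kernel_degree k Q\<close> is \<open>d\<close> resp. \<open>d\<^sub>n\<close>,
  \<open>normalized_kernel k Q\<close> is \<open>h\<close> resp. \<open>h\<^sub>n\<close>.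
\<close>

definition kernel_degree :: "('a \<Rightarrow> 'a \<Rightarrow> real) \<Rightarrow> 'a measure \<Rightarrow> 'a \<Rightarrow> real" where
  "kernel_degree k Q x = (\<integral>y. k x y \<partial>Q)"

definition normalized_kernel :: "('a \<Rightarrow> 'a \<Rightarrow> real) \<Rightarrow> 'a measure \<Rightarrow> 'a \<Rightarrow> 'a \<Rightarrow> real" where
  "normalized_kernel k Q x y = k x y / sqrt (kernel_degree k Q x * kernel_degree k Q y)"

definition normalized_operator ::
  "('a \<Rightarrow> 'a \<Rightarrow> real) \<Rightarrow> 'a measure \<Rightarrow> ('a \<Rightarrow> real) \<Rightarrow> 'a \<Rightarrow> real" where
  "normalized_operator k Q f x =
     (if x \<in> space Q then (\<integral>y. normalized_kernel k Q x y * f y \<partial>Q) else 0)"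

definition eigenfunction ::
  "('a \<Rightarrow> real) set \<Rightarrow> (('a \<Rightarrow> real) \<Rightarrow> 'a \<Rightarrow> real) \<Rightarrow> real \<Rightarrow> ('a \<Rightarrow> real) \<Rightarrow> bool" where
  "eigenfunction V A l f \<longleftrightarrow> f \<in> V \<and> f \<noteq> 0 \<and> A f = (\<lambda>x. l * f x)"

definition generalized_eigenspace ::
  "('a \<Rightarrow> real) set \<Rightarrow> (('a \<Rightarrow> real) \<Rightarrow> 'a \<Rightarrow> real) \<Rightarrow> real \<Rightarrow> ('a \<Rightarrow> real) set" where
  "generalized_eigenspace V A l =
     {f \<in> V. \<exists>j. ((\<lambda>g x. A g x - l * g x) ^^ j) f = 0}"

text \<open>
  \<open>fun_vs.dim\<close> is 0 on infinite-dimensional spaces, so multiplicity 1 does mean a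
  one-dimensional generalized eigenspace.
\<close>

definition algebraic_multiplicity ::
  "('a \<Rightarrow> real) set \<Rightarrow> (('a \<Rightarrow> real) \<Rightarrow> 'a \<Rightarrow> real) \<Rightarrow> real \<Rightarrow> nat" where
  "algebraic_multiplicity V A l = fun_vs.dim (generalized_eigenspace V A l)"

definition simple_eigenvalue ::
  "('a \<Rightarrow> real) set \<Rightarrow> (('a \<Rightarrow> real) \<Rightarrow> 'a \<Rightarrow> real) \<Rightarrow> real \<Rightarrow> bool" where
  "simple_eigenvalue V A l \<longleftrightarrow> (\<exists>f. eigenfunction V A l f) \<and> algebraic_multiplicity V A l = 1"

end

theory Submission
  imports Defs "HOL-Complex_Analysis.Great_Picard"
begin

text \<open>
  Simplicity of \<open>\<lambda>\<close> and compactness of \<open>T\<close> make \<open>T - \<lambda>\<close> bounded below in sup norm on the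
  \<open>L\<^sup>2(P)\<close>-orthogonal complement of \<open>u\<close>. Pairing \<open>(T - \<lambda>\<^sub>n) u\<^sub>n\<close> with \<open>u\<close> and using that \<open>T\<close> is
  symmetric bounds \<open>\<bar>\<lambda>\<^sub>n - \<lambda>\<bar>\<close> by \<open>\<parallel>(T - T\<^sub>n) u\<^sub>n\<parallel>\<close>; hence so is, up to a sign, the distance of \<open>u\<^sub>n\<close>
  to \<open>u\<close>. Since \<open>u\<^sub>n = T\<^sub>n u\<^sub>n / \<lambda>\<^sub>n\<close>, that residual is controlled by the
  uniform deviations of \<open>P\<^sub>n - P\<close> on the classes \<open>k(x, \<cdot>)\<close> and \<open>k(x, \<cdot>) k(\<cdot>, y) / d\<close>. By
  completing the square in the Gaussian both are, up to bounded factors, classes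
  \<open>z \<mapsto> exp(v \<bullet> z) g(z)\<close> with fixed bounded \<open>g\<close> and \<open>v\<close> in a ball; expanding the exponential
  reduces these to single functions, for which the \<open>1/\<surd>n\<close> rate is the variance of a mean.
\<close>

section \<open>Uniform deviations of empirical means\<close>

text \<open>The obstacle is that T - T_n need not be small in operator norm on C(S): if P has no
  atoms, a continuous function of norm 1 can equal 1 at every sample point and still have
  arbitrarily small P-mean. A rate is available only for functions that T_n has already smoothed,
  and eigenfunctions are of this kind. Their coefficients still depend on the sample, so the
  deviation bounds must be uniform in the second kernel argument, which may itself be a sample
  point. The factor 1/d in the second class is the product of two factors 1/sqrt d: one belongs to
  h, the other to the smoothed eigenfunction once d_n is replaced by d. The assumed convergence of
  \<lambda>_n comes without a rate; it places \<lambda>_n near \<lambda> and away from 0, and the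
  rate is derived from there.\<close>

lemma (in prob_space) bounded_real_integrable:
  fixes f :: "'a \<Rightarrow> real"
  assumes [measurable]: "f \<in> borel_measurable M"
    and B: "\<And>x. x \<in> space M \<Longrightarrow> \<bar>f x\<bar> \<le> B"
  shows "integrable M f"
    and "integrable M (\<lambda>x. (f x)\<^sup>2)"
    and "\<bar>expectation f\<bar> \<le> B"
    and "expectation (\<lambda>x. (f x)\<^sup>2) \<le> B\<^sup>2"
proof -
  show 1: "integrable M f"
    using B by (intro integrable_const_bound[where B = B]) auto
  have sq: "(f x)\<^sup>2 \<le> B\<^sup>2" if "x \<in> space M" for x
    using B[OF that] by (metis abs_ge_zero power2_abs power_mono)
  then show 2: "integrable M (\<lambda>x. (f x)\<^sup>2)"
    by (intro integrable_const_bound[where B = "B\<^sup>2"]) auto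
  have "\<bar>expectation f\<bar> \<le> expectation (\<lambda>x. \<bar>f x\<bar>)"
    by (rule integral_abs_bound)
  also have "\<dots> \<le> expectation (\<lambda>x. B)"
    using B 1 by (intro integral_mono) auto
  finally show "\<bar>expectation f\<bar> \<le> B" by (simp add: prob_space)
  have "expectation (\<lambda>x. (f x)\<^sup>2) \<le> expectation (\<lambda>x. B\<^sup>2)"
    using sq 2 by (intro integral_mono) auto
  then show "expectation (\<lambda>x. (f x)\<^sup>2) \<le> B\<^sup>2" by (simp add: prob_space)
qed

text \<open>Cross terms vanish because each summand is centred and independent of the sum of the
  others. \<open>K\<close> serves integrability and \<open>V\<close> the bound; they are kept apart
  because centring may double a sup bound but does not raise the second moment.\<close>

lemma (in prob_space) expectation_square_sum_indep_le:
  fixes Y :: "'i \<Rightarrow> 'a \<Rightarrow> real"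
  assumes "finite I" and "indep_vars (\<lambda>_. borel) Y I"
    and bound: "\<And>i \<omega>. i \<in> I \<Longrightarrow> \<omega> \<in> space M \<Longrightarrow> \<bar>Y i \<omega>\<bar> \<le> K"
    and mean: "\<And>i. i \<in> I \<Longrightarrow> expectation (Y i) = 0"
    and second: "\<And>i. i \<in> I \<Longrightarrow> expectation (\<lambda>\<omega>. (Y i \<omega>)\<^sup>2) \<le> V"
  shows "expectation (\<lambda>\<omega>. (\<Sum>i\<in>I. Y i \<omega>)\<^sup>2) \<le> real (card I) * V"
  using assms
proof (induction I rule: finite_induct)
  case empty
  then show ?case by simp
next
  case (insert j I)
  let ?S = "\<lambda>\<omega>. \<Sum>i\<in>I. Y i \<omega>"
  have rv: "Y i \<in> borel_measurable M" if "i \<in> insert j I" for i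
    using insert.prems(1) that unfolding indep_vars_def by auto
  have S_meas [measurable]: "?S \<in> borel_measurable M"
    using rv by (auto intro!: borel_measurable_sum)
  have Yj_meas [measurable]: "Y j \<in> borel_measurable M"
    using rv by auto
  have Yb: "\<bar>Y i \<omega>\<bar> \<le> K" if "i \<in> insert j I" "\<omega> \<in> space M" for i \<omega>
    using insert.prems(2) that by auto
  have Sb: "\<bar>?S \<omega>\<bar> \<le> real (card I) * K" if "\<omega> \<in> space M" for \<omega>
    using Yb that by (intro order.trans[OF sum_abs] sum_bounded_above) auto
  have int_Y: "integrable M (Y j)" and int_Y2: "integrable M (\<lambda>\<omega>. (Y j \<omega>)\<^sup>2)"
    using Yb by (auto intro!: bounded_real_integrable[where B = K])
  have int_S: "integrable M ?S" and int_S2: "integrable M (\<lambda>\<omega>. (?S \<omega>)\<^sup>2)"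
    using Sb by (auto intro!: bounded_real_integrable[where B = "real (card I) * K"])
  have ind: "indep_var borel (Y j) borel ?S"
    using insert by (intro indep_vars_sum) auto
  have int_YS: "integrable M (\<lambda>\<omega>. Y j \<omega> * ?S \<omega>)"
    by (rule indep_var_integrable[OF ind int_Y int_S])
  have "expectation (\<lambda>\<omega>. Y j \<omega> * ?S \<omega>) = 0"
    using indep_var_lebesgue_integral[OF ind int_Y int_S] insert.prems(3) by simp
  have "(\<Sum>i\<in>insert j I. Y i \<omega>)\<^sup>2 = (Y j \<omega>)\<^sup>2 + 2 * (Y j \<omega> * ?S \<omega>) + (?S \<omega>)\<^sup>2" for \<omega>
    using insert.hyps by (simp add: power2_sum)
  then have "expectation (\<lambda>\<omega>. (\<Sum>i\<in>insert j I. Y i \<omega>)\<^sup>2) =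
      expectation (\<lambda>\<omega>. (Y j \<omega>)\<^sup>2) + expectation (\<lambda>\<omega>. (?S \<omega>)\<^sup>2)"
    using int_Y2 int_S2 int_YS \<open>expectation (\<lambda>\<omega>. Y j \<omega> * ?S \<omega>) = 0\<close> by simp
  also have "\<dots> \<le> V + real (card I) * V"
  proof (rule add_mono)
    show "expectation (\<lambda>\<omega>. (Y j \<omega>)\<^sup>2) \<le> V"
      using insert.prems by auto
    show "expectation (\<lambda>\<omega>. (?S \<omega>)\<^sup>2) \<le> real (card I) * V"
      using insert.prems indep_vars_subset[OF insert.prems(1), of I] by (intro insert.IH) auto
  qed
  finally show ?case
    using insert.hyps by (simp add: algebra_simps)
qed

text \<open>This is (P_n - P) g. The empirical half is a plain finite sum, so that rearranging it
  needs no measurability; \<open>integral_empirical_measure\<close> later links it to the integrals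
  in the operators.\<close>

definition deviation :: "'b measure \<Rightarrow> (nat \<Rightarrow> 'b) \<Rightarrow> nat \<Rightarrow> ('b \<Rightarrow> real) \<Rightarrow> real" where
  "deviation P x n g = (\<Sum>i=1..n. g (x i)) / real n - (\<integral>z. g z \<partial>P)"

text \<open>Crude and without decay in n: meant for functions that are already small, and for
  absolute summability of series of deviations.\<close>

lemma (in prob_space) deviation_abs_le:
  assumes g: "g \<in> borel_measurable M" and B: "\<And>z. z \<in> space M \<Longrightarrow> \<bar>g z\<bar> \<le> B"
    and x: "\<And>i. i \<ge> 1 \<Longrightarrow> x i \<in> space M" and "n \<ge> 1"
  shows "\<bar>deviation M x n g\<bar> \<le> 2 * B"
proof -
  have "\<bar>\<Sum>i=1..n. g (x i)\<bar> \<le> real (card {1..n}) * B"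
    using B x by (intro order.trans[OF sum_abs] sum_bounded_above) auto
  then have "\<bar>(\<Sum>i=1..n. g (x i)) / real n\<bar> \<le> B"
    using \<open>n \<ge> 1\<close> by (simp only: abs_divide) (simp add: field_simps)
  with bounded_real_integrable(3)[OF g B] show ?thesis
    unfolding deviation_def by linarith
qed

locale iid_sample = prob_space M + P: prob_space P
  for M :: "'w measure" and P :: "'b measure" +
  fixes X :: "nat \<Rightarrow> 'w \<Rightarrow> 'b"
  assumes indep: "indep_vars (\<lambda>_. P) X {1..}"
    and distr_X: "\<And>i. i \<ge> 1 \<Longrightarrow> distr M P (X i) = P"
begin

lemma X_measurable: "i \<ge> 1 \<Longrightarrow> X i \<in> measurable M P"
  using indep by (auto simp: indep_vars_def)

lemma X_in_space: "i \<ge> 1 \<Longrightarrow> \<omega> \<in> space M \<Longrightarrow> X i \<omega> \<in> space P"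
  using X_measurable by (auto dest: measurable_space)

lemma expectation_X:
  fixes g :: "'b \<Rightarrow> real"
  assumes "g \<in> borel_measurable P" "i \<ge> 1"
  shows "expectation (\<lambda>\<omega>. g (X i \<omega>)) = (\<integral>z. g z \<partial>P)"
  using integral_distr[OF X_measurable assms(1)] assms distr_X by simp

lemma borel_measurable_deviation:
  assumes "g \<in> borel_measurable P"
  shows "(\<lambda>\<omega>. deviation P (\<lambda>i. X i \<omega>) n g) \<in> borel_measurable M"
  unfolding deviation_def
  by (intro borel_measurable_diff borel_measurable_divide borel_measurable_sum
        borel_measurable_const measurable_compose[OF X_measurable assms]) auto

lemma expectation_deviation_square_le:
  assumes g [measurable]: "g \<in> borel_measurable P"
    and B: "\<And>z. z \<in> space P \<Longrightarrow> \<bar>g z\<bar> \<le> B" and "n \<ge> 1"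
  shows "expectation (\<lambda>\<omega>. (deviation P (\<lambda>i. X i \<omega>) n g)\<^sup>2) \<le> B\<^sup>2 / real n"
proof -
  define m where "m = (\<integral>z. g z \<partial>P)"
  define Y where "Y = (\<lambda>i \<omega>. g (X i \<omega>) - m)"
  note g_bounds = P.bounded_real_integrable[OF g B]
  have int_g: "integrable P g" and int_g2: "integrable P (\<lambda>z. (g z)\<^sup>2)"
    using g_bounds by blast+
  have "\<bar>m\<bar> \<le> B"
    using g_bounds(3) by (simp add: m_def)
  have "expectation (\<lambda>\<omega>. (\<Sum>i\<in>{1..n}. Y i \<omega>)\<^sup>2) \<le> real (card {1..n}) * B\<^sup>2"
  proof (rule expectation_square_sum_indep_le)
    show "indep_vars (\<lambda>_. borel) Y {1..n}"
      unfolding Y_def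
      by (rule indep_vars_compose2[OF indep_vars_subset[OF indep]]) auto
    show "\<bar>Y i \<omega>\<bar> \<le> 2 * B" if "i \<in> {1..n}" "\<omega> \<in> space M" for i \<omega>
      using B[OF X_in_space, of i \<omega>] that \<open>\<bar>m\<bar> \<le> B\<close> by (auto simp: Y_def)
    show "expectation (Y i) = 0" if "i \<in> {1..n}" for i
      using expectation_X[of "\<lambda>z. g z - m" i] that int_g
      by (simp add: Y_def m_def P.prob_space)
    show "expectation (\<lambda>\<omega>. (Y i \<omega>)\<^sup>2) \<le> B\<^sup>2" if "i \<in> {1..n}" for i
    proof -
      have "expectation (\<lambda>\<omega>. (Y i \<omega>)\<^sup>2) = (\<integral>z. (g z - m)\<^sup>2 \<partial>P)"
        using expectation_X[of "\<lambda>z. (g z - m)\<^sup>2" i] that by (simp add: Y_def)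
      also have "\<dots> = (\<integral>z. (g z)\<^sup>2 \<partial>P) - m\<^sup>2"
        unfolding m_def by (rule P.variance_eq[OF int_g int_g2])
      also have "\<dots> \<le> B\<^sup>2"
        using g_bounds(4) zero_le_power2[of m] by linarith
      finally show ?thesis .
    qed
  qed auto
  moreover have "deviation P (\<lambda>i. X i \<omega>) n g = (\<Sum>i\<in>{1..n}. Y i \<omega>) / real n" for \<omega>
    using \<open>n \<ge> 1\<close> by (simp add: deviation_def Y_def m_def sum_subtractf field_simps)
  ultimately show ?thesis
    using \<open>n \<ge> 1\<close> by (simp add: power_divide) (simp add: field_simps power2_eq_square)
qed

text \<open>First moments are recorded instead of second ones because they add up under the sums and
  series of envelopes below; the \<open>nn_integral\<close> form spares any integrability proof for
  those envelopes.\<close>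

lemma nn_integral_abs_deviation_le:
  assumes g [measurable]: "g \<in> borel_measurable P"
    and B: "\<And>z. z \<in> space P \<Longrightarrow> \<bar>g z\<bar> \<le> B" and "n \<ge> 1"
  shows "(\<integral>\<^sup>+\<omega>. ennreal \<bar>deviation P (\<lambda>i. X i \<omega>) n g\<bar> \<partial>M) \<le> ennreal (B / sqrt (real n))"
proof -
  let ?D = "\<lambda>\<omega>. deviation P (\<lambda>i. X i \<omega>) n g"
  have D_meas [measurable]: "?D \<in> borel_measurable M"
    by (rule borel_measurable_deviation) fact
  have "B \<ge> 0"
    using B P.not_empty by (metis abs_ge_zero all_not_in_conv order.trans)
  have Db: "\<bar>?D \<omega>\<bar> \<le> 2 * B" if "\<omega> \<in> space M" for \<omega>
    using X_in_space that assms by (intro P.deviation_abs_le) auto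
  have int_D: "integrable M ?D" and int_D2: "integrable M (\<lambda>\<omega>. (?D \<omega>)\<^sup>2)"
    using Db by (auto intro!: bounded_real_integrable[where B = "2 * B"])
  \<comment> \<open>Jensen's inequality for the square, read off from the nonnegativity of a
    variance.\<close>
  have "(expectation (\<lambda>\<omega>. \<bar>?D \<omega>\<bar>))\<^sup>2 \<le> expectation (\<lambda>\<omega>. \<bar>?D \<omega>\<bar>\<^sup>2)"
  proof -
    have "0 \<le> variance (\<lambda>\<omega>. \<bar>?D \<omega>\<bar>)" by (rule variance_positive)
    also have "\<dots> = expectation (\<lambda>\<omega>. \<bar>?D \<omega>\<bar>\<^sup>2) - (expectation (\<lambda>\<omega>. \<bar>?D \<omega>\<bar>))\<^sup>2"
      using int_D int_D2 by (intro variance_eq) auto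
    finally show ?thesis by simp
  qed
  also have "\<dots> \<le> (B / sqrt (real n))\<^sup>2"
    using expectation_deviation_square_le[OF assms] by (simp add: power_divide)
  finally have "expectation (\<lambda>\<omega>. \<bar>?D \<omega>\<bar>) \<le> B / sqrt (real n)"
    using \<open>B \<ge> 0\<close> by (auto intro: power2_le_imp_le)
  then show ?thesis
    using int_D by (subst nn_integral_eq_integral) (auto intro: ennreal_leI)
qed

end

section \<open>Linearity and term-by-term summation of deviations\<close>

lemma deviation_sum:
  assumes "\<And>b. b \<in> I \<Longrightarrow> integrable P (g b)"
  shows "deviation P x n (\<lambda>z. \<Sum>b\<in>I. c b * g b z) = (\<Sum>b\<in>I. c b * deviation P x n (g b))"
proof -
  have "(\<Sum>i=1..n. \<Sum>b\<in>I. c b * g b (x i)) / real n = (\<Sum>b\<in>I. c b * ((\<Sum>i=1..n. g b (x i)) / real n))"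
    by (subst sum.swap) (simp add: sum_distrib_left sum_divide_distrib)
  then show ?thesis
    using assms by (simp add: deviation_def sum_subtractf right_diff_distrib)
qed

lemma deviation_add:
  assumes "integrable P f" "integrable P g"
  shows "deviation P x n (\<lambda>y. f y + g y) = deviation P x n f + deviation P x n g"
  using assms by (simp add: deviation_def sum.distrib add_divide_distrib)

lemma deviation_mult_left: "deviation P x n (\<lambda>z. c * g z) = c * deviation P x n g"
  by (simp add: deviation_def sum_distrib_left right_diff_distrib)

text \<open>At the finitely many sample points pointwise convergence is enough; on the P side,
  \<open>int_abs\<close> licenses the exchange of series and integral.\<close>

lemma deviation_sums:
  fixes g :: "nat \<Rightarrow> 'b \<Rightarrow> real"
  assumes x: "\<And>i. i \<ge> 1 \<Longrightarrow> x i \<in> space P"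
    and int: "\<And>j. integrable P (g j)"
    and sums: "\<And>z. z \<in> space P \<Longrightarrow> (\<lambda>j. g j z) sums G z"
    and abs: "\<And>z. z \<in> space P \<Longrightarrow> summable (\<lambda>j. \<bar>g j z\<bar>)"
    and int_abs: "summable (\<lambda>j. \<integral>z. \<bar>g j z\<bar> \<partial>P)"
  shows "(\<lambda>j. deviation P x n (g j)) sums deviation P x n G"
proof -
  have "(\<lambda>j. \<integral>z. g j z \<partial>P) sums (\<integral>z. (\<Sum>j. g j z) \<partial>P)"
    using int abs int_abs by (intro sums_integral) auto
  also have "(\<integral>z. (\<Sum>j. g j z) \<partial>P) = (\<integral>z. G z \<partial>P)"
    using sums by (intro Bochner_Integration.integral_cong) (auto simp: sums_iff)
  finally have "(\<lambda>j. \<integral>z. g j z \<partial>P) sums (\<integral>z. G z \<partial>P)" .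
  moreover have "(\<lambda>j. (\<Sum>i=1..n. g j (x i)) / real n) sums ((\<Sum>i=1..n. G (x i)) / real n)"
    using x sums by (intro sums_divide sums_sum) auto
  ultimately show ?thesis
    unfolding deviation_def by (intro sums_diff)
qed

text \<open>The law lives on the trace sigma-algebra of a subset in the application, so the Borel
  structure enters as measurability of the inclusion map. This suffices for all functions
  \<open>v \<bullet> z\<close>.\<close>

locale bounded_iid_sample = iid_sample M P X
  for M :: "'w measure" and P :: "'b::euclidean_space measure" and X +
  fixes R :: real
  assumes id_measurable [measurable]: "(\<lambda>z. z) \<in> borel_measurable P"
    and norm_le: "\<And>z. z \<in> space P \<Longrightarrow> norm z \<le> R"
begin

lemma R_nonneg: "0 \<le> R"
  using norm_le P.not_empty by (meson all_not_in_conv norm_ge_zero order.trans)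

lemma abs_inner_le:
  assumes "norm v \<le> r" "z \<in> space P"
  shows "\<bar>v \<bullet> z\<bar> \<le> r * R"
  using Cauchy_Schwarz_ineq2[of v z] norm_le[OF assms(2)] assms(1)
  by (meson mult_mono norm_ge_zero order.trans)

text \<open>
  Induction on \<open>j\<close>: expanding one factor \<open>v \<bullet> z\<close> in coordinates moves the dependence on \<open>v\<close>
  out of the deviation and multiplies \<open>g\<close> by a coordinate function. The envelope \<open>W\<close> stands in for
  the supremum over \<open>v\<close>, whose measurability is thereby never needed.
\<close>

lemma power_class_deviation_bound:
  fixes g :: "'b \<Rightarrow> real"
  assumes "n \<ge> 1" "0 \<le> r"
    and "g \<in> borel_measurable P" "\<And>z. z \<in> space P \<Longrightarrow> \<bar>g z\<bar> \<le> B"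
  shows "\<exists>W\<in>borel_measurable M.
    (\<forall>\<omega>\<in>space M. \<forall>v. norm v \<le> r \<longrightarrow>
       ennreal \<bar>deviation P (\<lambda>i. X i \<omega>) n (\<lambda>z. (v \<bullet> z) ^ j * g z)\<bar> \<le> W \<omega>) \<and>
    (\<integral>\<^sup>+\<omega>. W \<omega> \<partial>M) \<le> ennreal ((real DIM('b) * r * R) ^ j * B / sqrt (real n))"
  using assms(3,4)
proof (induction j arbitrary: g B)
  case 0
  show ?case
  proof (intro bexI conjI)
    show "(\<integral>\<^sup>+\<omega>. ennreal \<bar>deviation P (\<lambda>i. X i \<omega>) n g\<bar> \<partial>M)
        \<le> ennreal ((real DIM('b) * r * R) ^ 0 * B / sqrt (real n))"
      using nn_integral_abs_deviation_le[OF 0 assms(1)] by simp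
    show "(\<lambda>\<omega>. ennreal \<bar>deviation P (\<lambda>i. X i \<omega>) n g\<bar>) \<in> borel_measurable M"
      using borel_measurable_deviation[OF 0(1), of n] by measurable
  qed auto
next
  case (Suc j)
  note [measurable] = Suc.prems(1)
  let ?D = "\<lambda>\<omega>. deviation P (\<lambda>i. X i \<omega>) n"
  \<comment> \<open>The induction hypothesis for \<open>(z \<bullet> b) * g z\<close>, whose sup
    bound is \<open>R * B\<close>. Adding \<open>r * ?c\<close> over the DIM('b) basis vectors
    produces the bound for \<open>Suc j\<close>.\<close>
  let ?c = "(real DIM('b) * r * R) ^ j * (R * B) / sqrt (real n)"
  have "B \<ge> 0"
    using Suc.prems(2) P.not_empty by (metis abs_ge_zero all_not_in_conv order.trans)
  have zb: "\<bar>(z \<bullet> b) * g z\<bar> \<le> R * B" if "b \<in> Basis" "z \<in> space P" for b z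
    using Suc.prems(2)[OF that(2)] norm_le[OF that(2)] Basis_le_norm[OF that(1), of z] R_nonneg
    by (auto simp: abs_mult intro!: mult_mono)
  \<comment> \<open>Bundling all properties of an envelope into one predicate lets envelopes for all
    basis vectors be chosen at once.\<close>
  define Q where "Q b W \<longleftrightarrow> W \<in> borel_measurable M \<and>
    (\<forall>\<omega>\<in>space M. \<forall>v. norm v \<le> r \<longrightarrow>
       ennreal \<bar>?D \<omega> (\<lambda>z. (v \<bullet> z) ^ j * ((z \<bullet> b) * g z))\<bar> \<le> W \<omega>) \<and>
    (\<integral>\<^sup>+\<omega>. W \<omega> \<partial>M) \<le> ennreal ?c" for b W
  have "\<exists>W. Q b W" if b: "b \<in> Basis" for b
  proof -
    have "(\<lambda>z. (z \<bullet> b) * g z) \<in> borel_measurable P" by measurable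
    from Suc.IH[OF this zb[OF b]] show ?thesis
      unfolding Q_def by blast
  qed
  then obtain W where W_Q: "\<And>b. b \<in> Basis \<Longrightarrow> Q b (W b)"
    by metis
  then have W_meas: "\<And>b. b \<in> Basis \<Longrightarrow> W b \<in> borel_measurable M"
    and W: "\<And>b \<omega> v. b \<in> Basis \<Longrightarrow> \<omega> \<in> space M \<Longrightarrow> norm v \<le> r \<Longrightarrow>
       ennreal \<bar>?D \<omega> (\<lambda>z. (v \<bullet> z) ^ j * ((z \<bullet> b) * g z))\<bar> \<le> W b \<omega>"
    and int_W: "\<And>b. b \<in> Basis \<Longrightarrow> (\<integral>\<^sup>+\<omega>. W b \<omega> \<partial>M) \<le> ennreal ?c"
    unfolding Q_def by auto
  show ?case
  proof (intro bexI conjI ballI allI impI)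
    fix \<omega> and v :: 'b assume \<omega>: "\<omega> \<in> space M" and v: "norm v \<le> r"
    have int: "integrable P (\<lambda>z. (v \<bullet> z) ^ j * ((z \<bullet> b) * g z))" if "b \<in> Basis" for b
    proof (rule P.bounded_real_integrable(1))
      fix z assume z: "z \<in> space P"
      show "\<bar>(v \<bullet> z) ^ j * ((z \<bullet> b) * g z)\<bar> \<le> (r * R) ^ j * (R * B)"
        unfolding abs_mult[of "(v \<bullet> z) ^ j"] power_abs
        using zb[OF that z] abs_inner_le[OF v z] assms(2) R_nonneg
        by (intro mult_mono power_mono) auto
    qed measurable
    have "(v \<bullet> z) ^ Suc j * g z = (\<Sum>b\<in>Basis. (v \<bullet> b) * ((v \<bullet> z) ^ j * ((z \<bullet> b) * g z)))" for z
      by (simp add: euclidean_inner[of v z] sum_distrib_right sum_distrib_left mult_ac)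
    then have "?D \<omega> (\<lambda>z. (v \<bullet> z) ^ Suc j * g z) =
        (\<Sum>b\<in>Basis. (v \<bullet> b) * ?D \<omega> (\<lambda>z. (v \<bullet> z) ^ j * ((z \<bullet> b) * g z)))"
      using deviation_sum[OF int] by simp
    also have "\<bar>\<dots>\<bar> \<le> (\<Sum>b\<in>Basis. r * \<bar>?D \<omega> (\<lambda>z. (v \<bullet> z) ^ j * ((z \<bullet> b) * g z))\<bar>)"
      using v by (intro order.trans[OF sum_abs] sum_mono)
        (auto simp: abs_mult intro!: mult_right_mono order.trans[OF Basis_le_norm])
    finally have "ennreal \<bar>?D \<omega> (\<lambda>z. (v \<bullet> z) ^ Suc j * g z)\<bar> \<le>
        ennreal (\<Sum>b\<in>Basis. r * \<bar>?D \<omega> (\<lambda>z. (v \<bullet> z) ^ j * ((z \<bullet> b) * g z))\<bar>)"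
      by (rule ennreal_leI)
    also have "\<dots> = (\<Sum>b\<in>Basis. ennreal r * ennreal \<bar>?D \<omega> (\<lambda>z. (v \<bullet> z) ^ j * ((z \<bullet> b) * g z))\<bar>)"
      using assms(2) by (simp add: sum_ennreal[symmetric] ennreal_mult)
    also have "\<dots> \<le> (\<Sum>b\<in>Basis. ennreal r * W b \<omega>)"
      using W \<omega> v by (intro sum_mono mult_left_mono) auto
    finally show "ennreal \<bar>?D \<omega> (\<lambda>z. (v \<bullet> z) ^ Suc j * g z)\<bar> \<le> (\<Sum>b\<in>Basis. ennreal r * W b \<omega>)" .
  next
    have "(\<integral>\<^sup>+\<omega>. (\<Sum>b\<in>Basis. ennreal r * W b \<omega>) \<partial>M) = (\<Sum>b\<in>Basis. ennreal r * (\<integral>\<^sup>+\<omega>. W b \<omega> \<partial>M))"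
      using W_meas by (simp add: nn_integral_sum nn_integral_cmult)
    also have "\<dots> \<le> (\<Sum>b\<in>(Basis :: 'b set). ennreal r * ennreal ?c)"
      using int_W by (intro sum_mono mult_left_mono) auto
    also have "\<dots> = ennreal (real DIM('b) * (r * ?c))"
      using assms(2) R_nonneg \<open>B \<ge> 0\<close>
      by (simp add: ennreal_mult[symmetric] ennreal_of_nat_eq_real_of_nat)
    also have "real DIM('b) * (r * ?c) = (real DIM('b) * r * R) ^ Suc j * B / sqrt (real n)"
      by simp
    finally show "(\<integral>\<^sup>+\<omega>. (\<Sum>b\<in>Basis. ennreal r * W b \<omega>) \<partial>M) \<le>
      ennreal ((real DIM('b) * r * R) ^ Suc j * B / sqrt (real n))" .
    show "(\<lambda>\<omega>. \<Sum>b\<in>Basis. ennreal r * W b \<omega>) \<in> borel_measurable M"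
      using W_meas by (intro borel_measurable_sum borel_measurable_times_ennreal) auto
  qed
qed

text \<open>The factor DIM('b)^j lost by expanding j inner products in coordinates is absorbed by
  1/j!, so the first moments of the envelopes sum to an exponential. Since no covering of the ball
  of vectors v is involved, no logarithm of n appears.\<close>

lemma exp_class_deviation_bound:
  fixes g :: "'b \<Rightarrow> real"
  assumes "n \<ge> 1" "0 \<le> r"
    and g [measurable]: "g \<in> borel_measurable P" and B: "\<And>z. z \<in> space P \<Longrightarrow> \<bar>g z\<bar> \<le> B"
  shows "\<exists>W\<in>borel_measurable M.
    (\<forall>\<omega>\<in>space M. \<forall>v. norm v \<le> r \<longrightarrow>
       ennreal \<bar>deviation P (\<lambda>i. X i \<omega>) n (\<lambda>z. exp (v \<bullet> z) * g z)\<bar> \<le> W \<omega>) \<and>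
    (\<integral>\<^sup>+\<omega>. W \<omega> \<partial>M) \<le> ennreal (exp (real DIM('b) * r * R) * B / sqrt (real n))"
proof -
  let ?D = "\<lambda>\<omega>. deviation P (\<lambda>i. X i \<omega>) n"
  let ?a = "real DIM('b) * r * R"
  have "B \<ge> 0"
    using B P.not_empty by (metis abs_ge_zero all_not_in_conv order.trans)
  define Q where "Q j W \<longleftrightarrow> W \<in> borel_measurable M \<and>
    (\<forall>\<omega>\<in>space M. \<forall>v. norm v \<le> r \<longrightarrow>
       ennreal \<bar>?D \<omega> (\<lambda>z. (v \<bullet> z) ^ j * g z)\<bar> \<le> W \<omega>) \<and>
    (\<integral>\<^sup>+\<omega>. W \<omega> \<partial>M) \<le> ennreal (?a ^ j * B / sqrt (real n))" for j W
  have "\<exists>W. Q j W" for j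
    using power_class_deviation_bound[OF assms, of j] unfolding Q_def by blast
  then obtain W where "\<And>j. Q j (W j)"
    by metis
  then have W_meas [measurable]: "\<And>j. W j \<in> borel_measurable M"
    and W: "\<And>j \<omega> v. \<omega> \<in> space M \<Longrightarrow> norm v \<le> r \<Longrightarrow>
       ennreal \<bar>?D \<omega> (\<lambda>z. (v \<bullet> z) ^ j * g z)\<bar> \<le> W j \<omega>"
    and int_W: "\<And>j. (\<integral>\<^sup>+\<omega>. W j \<omega> \<partial>M) \<le> ennreal (?a ^ j * B / sqrt (real n))"
    unfolding Q_def by auto
  show ?thesis
  proof (intro bexI conjI ballI allI impI)
    fix \<omega> and v :: 'b assume \<omega>: "\<omega> \<in> space M" and v: "norm v \<le> r"
    let ?g = "\<lambda>j z. (1 / fact j) * ((v \<bullet> z) ^ j * g z)"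
    have sg: "(\<lambda>j. ?g j z) sums (exp (v \<bullet> z) * g z)" for z
      using sums_mult2[OF exp_converges[of "v \<bullet> z"], of "g z"] by (simp add: field_simps)
    have bg: "\<bar>?g j z\<bar> \<le> (r * R) ^ j / fact j * B" if z: "z \<in> space P" for j z
    proof -
      have "\<bar>(v \<bullet> z) ^ j * g z\<bar> \<le> (r * R) ^ j * B"
        unfolding abs_mult power_abs
        using B[OF z] abs_inner_le[OF v z] assms(2) R_nonneg
        by (intro mult_mono power_mono) auto
      then show ?thesis by (simp add: abs_mult field_simps)
    qed
    \<comment> \<open>A deterministic majorant, independent of v and of the point. It justifies the
      exchanges of limits; the rate comes from the integrals of the envelopes alone.\<close>
    have se: "summable (\<lambda>j. (r * R) ^ j / fact j * B)"
      using summable_exp[of "r * R"] by (intro summable_mult2) (simp add: field_simps)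
    have ig: "integrable P (?g j)" for j
      by (rule P.bounded_real_integrable(1)[OF _ bg]) measurable
    have int_le: "\<bar>\<integral>z. \<bar>?g j z\<bar> \<partial>P\<bar> \<le> (r * R) ^ j / fact j * B" for j
      using bg by (intro P.bounded_real_integrable(3)) auto
    have sa: "summable (\<lambda>j. \<bar>?g j z\<bar>)" if "z \<in> space P" for z
      using bg[OF that] by (intro summable_comparison_test'[OF se, of 0]) auto
    have sia: "summable (\<lambda>j. \<integral>z. \<bar>?g j z\<bar> \<partial>P)"
      using int_le by (intro summable_comparison_test'[OF se, of 0]) auto
    have sD: "(\<lambda>j. ?D \<omega> (?g j)) sums ?D \<omega> (\<lambda>z. exp (v \<bullet> z) * g z)"
      using X_in_space \<omega> ig sg sa sia by (intro deviation_sums) auto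
    \<comment> \<open>The bound without rate suffices, since only absolute summability of the
      deviations is at stake.\<close>
    have "\<bar>?D \<omega> (?g j)\<bar> \<le> 2 * ((r * R) ^ j / fact j * B)" for j
      using bg X_in_space \<omega> assms(1) by (intro P.deviation_abs_le) measurable
    then have sDa: "summable (\<lambda>j. \<bar>?D \<omega> (?g j)\<bar>)"
      by (intro summable_comparison_test'[OF summable_mult[OF se, of 2], of 0]) auto
    have "ennreal \<bar>?D \<omega> (\<lambda>z. exp (v \<bullet> z) * g z)\<bar> \<le> ennreal (\<Sum>j. \<bar>?D \<omega> (?g j)\<bar>)"
      using summable_rabs[OF sDa] sD by (auto simp: sums_iff intro!: ennreal_leI)
    also have "\<dots> = (\<Sum>j. ennreal \<bar>?D \<omega> (?g j)\<bar>)"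
      using sDa by (simp add: suminf_ennreal2)
    also have "\<dots> = (\<Sum>j. ennreal (1 / fact j) * ennreal \<bar>?D \<omega> (\<lambda>z. (v \<bullet> z) ^ j * g z)\<bar>)"
      unfolding deviation_mult_left by (simp add: abs_mult ennreal_mult[symmetric])
    also have "\<dots> \<le> (\<Sum>j. ennreal (1 / fact j) * W j \<omega>)"
      using W[OF \<omega> v] by (intro suminf_le mult_left_mono) auto
    finally show "ennreal \<bar>?D \<omega> (\<lambda>z. exp (v \<bullet> z) * g z)\<bar> \<le> (\<Sum>j. ennreal (1 / fact j) * W j \<omega>)" .
  next
    have se: "(\<lambda>j. ?a ^ j / fact j * (B / sqrt (real n))) sums (exp ?a * (B / sqrt (real n)))"
      using exp_converges[of ?a] by (intro sums_mult2) (simp add: field_simps)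
    have "(\<integral>\<^sup>+\<omega>. (\<Sum>j. ennreal (1 / fact j) * W j \<omega>) \<partial>M) = (\<Sum>j. ennreal (1 / fact j) * (\<integral>\<^sup>+\<omega>. W j \<omega> \<partial>M))"
      by (simp add: nn_integral_suminf nn_integral_cmult)
    also have "\<dots> \<le> (\<Sum>j. ennreal (1 / fact j) * ennreal (?a ^ j * B / sqrt (real n)))"
      using int_W by (intro suminf_le mult_left_mono) auto
    also have "\<dots> = (\<Sum>j. ennreal (?a ^ j / fact j * (B / sqrt (real n))))"
      using assms(2) R_nonneg \<open>B \<ge> 0\<close> by (intro suminf_cong) (simp add: ennreal_mult[symmetric])
    also have "\<dots> = ennreal (exp ?a * (B / sqrt (real n)))"
      using se assms(2) R_nonneg \<open>B \<ge> 0\<close> by (subst suminf_ennreal2) (auto simp: sums_iff)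
    finally show "(\<integral>\<^sup>+\<omega>. (\<Sum>j. ennreal (1 / fact j) * W j \<omega>) \<partial>M) \<le>
        ennreal (exp ?a * B / sqrt (real n))" by simp
  qed measurable
qed

end

section \<open>Stability of a simple eigenpair of a symmetric integral operator\<close>

text \<open>A general kernel, because two instances are used: the normalized kernel, whose operator
  is T, and the Gaussian itself, whose operator applied to the constant 1 is the degree d.\<close>

locale continuous_kernel = prob_space P
  for P :: "'a::euclidean_space measure" +
  fixes S :: "'a set" and h :: "'a \<Rightarrow> 'a \<Rightarrow> real"
  assumes compact_S: "compact S"
    and sets_P: "sets P = sets (restrict_space borel S)"
    and support_P: "measure_support P = S"
    and continuous_h: "continuous_on (S \<times> S) (\<lambda>(x, y). h x y)"
    and sym_h: "\<And>x y. x \<in> S \<Longrightarrow> y \<in> S \<Longrightarrow> h x y = h y x"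
begin

definition integral_op :: "('a \<Rightarrow> real) \<Rightarrow> 'a \<Rightarrow> real" where
  "integral_op f x = (\<integral>y. h x y * f y \<partial>P)"

lemma space_P: "space P = S"
  using sets_eq_imp_space_eq[OF sets_P] by (simp add: space_restrict_space)

lemma S_nonempty: "S \<noteq> {}"
  using not_empty space_P by simp

lemma continuous_imp_measurable:
  fixes f :: "'a \<Rightarrow> real"
  assumes "continuous_on S f"
  shows "f \<in> borel_measurable P"
  using borel_measurable_continuous_on_restrict[OF assms] measurable_cong_sets[OF sets_P refl] by auto

lemma id_borel_measurable: "(\<lambda>z. z) \<in> borel_measurable P"
  using borel_measurable_continuous_on_restrict[OF continuous_on_id, of S]
    measurable_cong_sets[OF sets_P refl] by auto

lemma kernel_section_continuous: "x \<in> S \<Longrightarrow> continuous_on S (h x)"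
  using continuous_on_compose2[OF continuous_h, of S "\<lambda>y. (x, y)"]
  by (auto simp: image_subset_iff continuous_on_Pair)

lemma kernel_bounded: "\<exists>H>0. \<forall>x\<in>S. \<forall>y\<in>S. \<bar>h x y\<bar> \<le> H"
proof -
  have "bounded ((\<lambda>(x, y). h x y) ` (S \<times> S))"
    using compact_S by (intro compact_imp_bounded compact_continuous_image continuous_h compact_Times)
  then show ?thesis
    unfolding bounded_pos by force
qed

lemma continuous_bounded:
  fixes f :: "'a \<Rightarrow> real"
  assumes "continuous_on S f"
  shows "\<exists>B\<ge>0. \<forall>x\<in>S. \<bar>f x\<bar> \<le> B"
proof -
  obtain B where "B > 0" "\<forall>y\<in>f ` S. norm y \<le> B"
    using compact_imp_bounded[OF compact_continuous_image[OF assms compact_S]]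
    unfolding bounded_pos by blast
  then show ?thesis
    by (intro exI[of _ B]) auto
qed

lemma continuous_integrable:
  fixes f :: "'a \<Rightarrow> real"
  assumes "continuous_on S f"
  shows "integrable P f"
  using continuous_bounded[OF assms] bounded_real_integrable(1)[OF continuous_imp_measurable[OF assms]]
  by (auto simp: space_P)

lemma abs_integral_le:
  fixes f :: "'a \<Rightarrow> real"
  assumes "continuous_on S f" "\<And>x. x \<in> S \<Longrightarrow> \<bar>f x\<bar> \<le> B"
  shows "\<bar>\<integral>x. f x \<partial>P\<bar> \<le> B"
  using bounded_real_integrable(3)[OF continuous_imp_measurable[OF assms(1)]] assms(2)
  by (auto simp: space_P)

lemma integral_op_linear:
  assumes "continuous_on S f" "continuous_on S g" "x \<in> S"
  shows "integral_op (\<lambda>y. a * f y + b * g y) x = a * integral_op f x + b * integral_op g x"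
proof -
  have "integrable P (\<lambda>y. h x y * f y)" "integrable P (\<lambda>y. h x y * g y)"
    using assms by (auto intro!: continuous_integrable continuous_intros kernel_section_continuous)
  then have "(\<integral>y. a * (h x y * f y) + b * (h x y * g y) \<partial>P) = a * integral_op f x + b * integral_op g x"
    unfolding integral_op_def by simp
  then show ?thesis
    unfolding integral_op_def by (simp add: algebra_simps)
qed

lemma integral_op_le:
  assumes "continuous_on S f" "\<And>y. y \<in> S \<Longrightarrow> \<bar>f y\<bar> \<le> B" "x \<in> S"
    and "\<And>y. y \<in> S \<Longrightarrow> \<bar>h x y\<bar> \<le> H"
  shows "\<bar>integral_op f x\<bar> \<le> H * B"
  unfolding integral_op_def
  using assms abs_ge_zero
  by (intro abs_integral_le continuous_intros kernel_section_continuous)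
     (auto simp: abs_mult intro!: mult_mono intro: order.trans[OF abs_ge_zero])

text \<open>Uniform continuity of the kernel on the compact product gives a modulus that depends on
  f through its bound alone. Hence \<delta> is quantified before f and B: one statement yields both
  continuity of the image and equicontinuity of images of a bounded family.\<close>

lemma integral_op_equicontinuous:
  assumes "e > 0"
  shows "\<exists>\<delta>>0. \<forall>f B x x'. continuous_on S f \<longrightarrow> (\<forall>y\<in>S. \<bar>f y\<bar> \<le> B) \<longrightarrow> x \<in> S \<longrightarrow> x' \<in> S \<longrightarrow>
     dist x x' < \<delta> \<longrightarrow> \<bar>integral_op f x - integral_op f x'\<bar> \<le> e * B"
proof -
  have "uniformly_continuous_on (S \<times> S) (\<lambda>(x, y). h x y)"
    using compact_S by (intro compact_uniformly_continuous continuous_h compact_Times)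
  then obtain \<delta> where \<delta>: "\<delta> > 0" and
    "\<And>p q. p \<in> S \<times> S \<Longrightarrow> q \<in> S \<times> S \<Longrightarrow> dist q p < \<delta> \<Longrightarrow>
       dist ((\<lambda>(x, y). h x y) q) ((\<lambda>(x, y). h x y) p) < e"
    using assms unfolding uniformly_continuous_on_def by meson
  from this(2)[of "(_, _)" "(_, _)"] have hd:
    "\<bar>h x y - h x' y\<bar> < e" if "x \<in> S" "x' \<in> S" "y \<in> S" "dist x x' < \<delta>" for x x' y
    using that by (simp add: dist_Pair_Pair dist_real_def)
  have "\<bar>integral_op f x - integral_op f x'\<bar> \<le> e * B"
    if f: "continuous_on S f" "\<forall>y\<in>S. \<bar>f y\<bar> \<le> B" and x: "x \<in> S" "x' \<in> S" "dist x x' < \<delta>"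
    for f :: "'a \<Rightarrow> real" and B x x'
  proof -
    have "integrable P (\<lambda>y. h x y * f y)" "integrable P (\<lambda>y. h x' y * f y)"
      using f x by (auto intro!: continuous_integrable continuous_intros kernel_section_continuous)
    then have "integral_op f x - integral_op f x' = (\<integral>y. (h x y - h x' y) * f y \<partial>P)"
      unfolding integral_op_def by (simp add: left_diff_distrib)
    also have "\<bar>\<dots>\<bar> \<le> e * B"
    proof (rule abs_integral_le)
      show "continuous_on S (\<lambda>y. (h x y - h x' y) * f y)"
        using f x by (intro continuous_intros kernel_section_continuous) auto
      show "\<bar>(h x y - h x' y) * f y\<bar> \<le> e * B" if "y \<in> S" for y
        unfolding abs_mult using hd[of x x' y] that x f(2) assms by (intro mult_mono) auto
    qed
    finally show ?thesis .
  qed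
  with \<delta> show ?thesis by blast
qed

lemma integral_op_continuous:
  assumes f: "continuous_on S f"
  shows "continuous_on S (integral_op f)"
  unfolding continuous_on_iff
proof (intro ballI allI impI)
  fix x e :: _ assume x: "x \<in> S" and "(0 :: real) < e"
  obtain B where B: "B \<ge> 0" "\<forall>x\<in>S. \<bar>f x\<bar> \<le> B"
    using continuous_bounded[OF f] by blast
  \<comment> \<open>Dividing by \<open>B + 1\<close> covers B = 0 and leaves
    \<open>e / (B + 1) * B\<close> strictly below e.\<close>
  have "e / (B + 1) > 0" using \<open>0 < e\<close> B by simp
  from integral_op_equicontinuous[OF this] obtain \<delta> where "\<delta> > 0" and
    \<delta>: "\<And>x'. x' \<in> S \<Longrightarrow> dist x' x < \<delta> \<Longrightarrow> \<bar>integral_op f x' - integral_op f x\<bar> \<le> e / (B + 1) * B"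
    using f B(2) x by blast
  moreover have "e / (B + 1) * B < e"
    using \<open>0 < e\<close> B by (simp add: field_simps)
  ultimately show "\<exists>d>0. \<forall>x'\<in>S. dist x' x < d \<longrightarrow> dist (integral_op f x') (integral_op f x) < e"
    unfolding dist_real_def by (meson le_less_trans)
qed

lemma integral_op_self_adjoint:
  assumes f: "continuous_on S f" and g: "continuous_on S g"
  shows "(\<integral>x. integral_op f x * g x \<partial>P) = (\<integral>x. f x * integral_op g x \<partial>P)"
proof -
  interpret PP: pair_prob_space P P ..
  obtain H where H: "H > 0" "\<And>x y. x \<in> S \<Longrightarrow> y \<in> S \<Longrightarrow> \<bar>h x y\<bar> \<le> H"
    using kernel_bounded by blast
  obtain F where F: "F \<ge> 0" "\<And>x. x \<in> S \<Longrightarrow> \<bar>f x\<bar> \<le> F"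
    using continuous_bounded[OF f] by blast
  obtain G where G: "G \<ge> 0" "\<And>x. x \<in> S \<Longrightarrow> \<bar>g x\<bar> \<le> G"
    using continuous_bounded[OF g] by blast
  let ?q = "\<lambda>p. h (fst p) (snd p) * f (snd p) * g (fst p)"
  \<comment> \<open>Fubini needs h to be measurable for the product sigma-algebra, whereas
    continuity yields measurability for the Borel sets of \<open>S \<times> S\<close>;
    \<open>borel_prod\<close> reconciles the two.\<close>
  have "(\<lambda>p. (fst p, snd p)) \<in> P \<Otimes>\<^sub>M P \<rightarrow>\<^sub>M restrict_space borel (S \<times> S)"
  proof (rule measurable_restrict_space2)
    have "(\<lambda>p. (fst p, snd p)) \<in> P \<Otimes>\<^sub>M P \<rightarrow>\<^sub>M borel \<Otimes>\<^sub>M borel"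
      by (intro measurable_Pair measurable_compose[OF measurable_fst id_borel_measurable]
          measurable_compose[OF measurable_snd id_borel_measurable])
    then show "(\<lambda>p. (fst p, snd p)) \<in> borel_measurable (P \<Otimes>\<^sub>M P)"
      by (simp add: borel_prod)
  qed (auto simp: space_pair_measure space_P)
  from measurable_compose[OF this borel_measurable_continuous_on_restrict[OF continuous_h]]
  have [measurable]: "(\<lambda>p. h (fst p) (snd p)) \<in> borel_measurable (P \<Otimes>\<^sub>M P)" by simp
  note [measurable] = continuous_imp_measurable[OF f] continuous_imp_measurable[OF g]
  have "integrable (P \<Otimes>\<^sub>M P) ?q"
  proof (rule PP.bounded_real_integrable(1))
    fix p assume "p \<in> space (P \<Otimes>\<^sub>M P)"
    then show "\<bar>?q p\<bar> \<le> H * F * G"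
      using H F G by (auto simp: space_pair_measure space_P abs_mult intro!: mult_mono)
  qed measurable
  then have int: "integrable (P \<Otimes>\<^sub>M P) (\<lambda>(x, y). h x y * f y * g x)"
    by (simp add: case_prod_beta')
  have "(\<integral>x. integral_op f x * g x \<partial>P) = (\<integral>x. (\<integral>y. h x y * f y * g x \<partial>P) \<partial>P)"
    unfolding integral_op_def by simp
  also have "\<dots> = (\<integral>y. (\<integral>x. h x y * f y * g x \<partial>P) \<partial>P)"
    using PP.Fubini_integral[OF int] by simp
  also have "\<dots> = (\<integral>y. f y * integral_op g y \<partial>P)"
  proof (rule Bochner_Integration.integral_cong[OF refl])
    fix y assume y: "y \<in> space P"
    have "(\<integral>x. h x y * f y * g x \<partial>P) = (\<integral>x. f y * (h y x * g x) \<partial>P)"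
      using y sym_h by (intro Bochner_Integration.integral_cong) (auto simp: space_P)
    then show "(\<integral>x. h x y * f y * g x \<partial>P) = f y * integral_op g y"
      unfolding integral_op_def by simp
  qed
  finally show ?thesis .
qed

text \<open>Full support enters here: a continuous u that is nonzero at one point is nonzero on a
  nonempty relatively open set, which has positive mass. So u can be divided out in L^2(P) although
  all other estimates are in sup norm.\<close>

lemma integral_square_pos:
  fixes u :: "'a \<Rightarrow> real"
  assumes u: "continuous_on S u" and x: "x \<in> S" "u x \<noteq> 0"
  shows "(\<integral>y. u y * u y \<partial>P) > 0"
proof (rule ccontr)
  assume "\<not> (\<integral>y. u y * u y \<partial>P) > 0"
  moreover have "(\<integral>y. u y * u y \<partial>P) \<ge> 0"
    by (intro integral_nonneg_AE) auto
  ultimately have "(\<integral>y. u y * u y \<partial>P) = 0" by simp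
  moreover have "integrable P (\<lambda>y. u y * u y)"
    by (intro continuous_integrable continuous_intros u)
  ultimately have AE: "AE y in P. u y * u y = 0"
    by (subst (asm) integral_nonneg_eq_0_iff_AE) auto
  obtain U where U: "open U" "U \<inter> S = {y \<in> S. u y \<noteq> 0}"
  proof -
    have "openin (top_of_set S) (S \<inter> u -` (- {0}))"
      using u by (intro continuous_openin_preimage_gen) auto
    then obtain U where "open U" "S \<inter> u -` (- {0}) = S \<inter> U"
      unfolding openin_open by blast
    then show ?thesis
      by (intro that[of U]) auto
  qed
  have "U \<inter> S \<in> sets P"
    using U(1) by (auto simp: sets_P sets_restrict_space)
  then have "emeasure P (U \<inter> S) = 0"
    using AE U(2) by (subst (asm) AE_iff_measurable[where N = "U \<inter> S"]) (auto simp: space_P)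
  moreover have "x \<in> measure_support P" "x \<in> U"
    using x U(2) support_P by auto
  ultimately show False
    using U(1) by (auto simp: measure_support_def space_P)
qed

end

text \<open>Simplicity enters through \<open>eigenspace\<close>. The point \<open>x\<^sub>0\<close>,
  where u attains its norm, is fixed because the sign of a perturbed eigenfunction is read off
  there.\<close>

locale simple_eigenpair = continuous_kernel +
  fixes lam :: real and u :: "'a \<Rightarrow> real" and x\<^sub>0 :: 'a
  assumes lam_nonzero: "lam \<noteq> 0"
    and continuous_u: "continuous_on S u"
    and u_eigen: "\<And>x. x \<in> S \<Longrightarrow> integral_op u x = lam * u x"
    and u_le_1: "\<And>x. x \<in> S \<Longrightarrow> \<bar>u x\<bar> \<le> 1"
    and x\<^sub>0: "x\<^sub>0 \<in> S" "\<bar>u x\<^sub>0\<bar> = 1"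
    and eigenspace: "\<And>f. continuous_on S f \<Longrightarrow> (\<And>x. x \<in> S \<Longrightarrow> integral_op f x = lam * f x) \<Longrightarrow>
       \<exists>c. \<forall>x\<in>S. f x = c * u x"
begin

lemma integral_u_square_pos: "(\<integral>y. u y * u y \<partial>P) > 0"
  using integral_square_pos[OF continuous_u x\<^sub>0(1)] x\<^sub>0(2) by auto

text \<open>If no K works, there are g_j of norm 1, orthogonal to u, with residuals tending to 0. By
  Arzela-Ascoli a subsequence of T g_j converges uniformly, and since \<open>lam\<close> is nonzero
  so does g_j. The limit is an eigenfunction, hence a multiple of u, and orthogonality makes it 0,
  against norm 1.\<close>

lemma coercive_on_complement:
  "\<exists>K>0. \<forall>f B. continuous_on S f \<longrightarrow> (\<integral>x. f x * u x \<partial>P) = 0 \<longrightarrow>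
     (\<forall>x\<in>S. \<bar>integral_op f x - lam * f x\<bar> \<le> B) \<longrightarrow> (\<forall>x\<in>S. \<bar>f x\<bar> \<le> K * B)"
proof (rule ccontr)
  assume contra: "\<not> ?thesis"
  \<comment> \<open>The residual bound comes from the failure of the constant \<open>Suc j\<close>:
    dividing a counterexample f by its maximal absolute value s > Suc j * B scales its residual to
    at most B / s.\<close>
  define Q where "Q j g \<longleftrightarrow> continuous_on S g \<and> (\<integral>x. g x * u x \<partial>P) = 0 \<and> (\<forall>x\<in>S. \<bar>g x\<bar> \<le> 1) \<and>
      (\<exists>x\<in>S. \<bar>g x\<bar> = 1) \<and> (\<forall>x\<in>S. \<bar>integral_op g x - lam * g x\<bar> \<le> 1 / real (Suc j))" for j g
  have "\<exists>g. Q j g" for j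
  proof -
    have "\<exists>f B. continuous_on S f \<and> (\<integral>x. f x * u x \<partial>P) = 0 \<and>
      (\<forall>x\<in>S. \<bar>integral_op f x - lam * f x\<bar> \<le> B) \<and> (\<exists>x\<in>S. \<not> \<bar>f x\<bar> \<le> real (Suc j) * B)"
    proof (rule ccontr)
      assume "\<not> ?thesis"
      then have "\<forall>f B. continuous_on S f \<longrightarrow> (\<integral>x. f x * u x \<partial>P) = 0 \<longrightarrow>
         (\<forall>x\<in>S. \<bar>integral_op f x - lam * f x\<bar> \<le> B) \<longrightarrow> (\<forall>x\<in>S. \<bar>f x\<bar> \<le> real (Suc j) * B)"
        by blast
      moreover have "real (Suc j) > 0" by simp
      ultimately show False using contra by blast
    qed
    then obtain f B x where f: "continuous_on S f" "(\<integral>x. f x * u x \<partial>P) = 0"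
      and B: "\<And>x. x \<in> S \<Longrightarrow> \<bar>integral_op f x - lam * f x\<bar> \<le> B"
      and x: "x \<in> S" "\<bar>f x\<bar> > real (Suc j) * B"
      unfolding not_le by blast
    have "B \<ge> 0" using B[OF x(1)] by linarith
    obtain y where y: "y \<in> S" "\<And>x. x \<in> S \<Longrightarrow> \<bar>f x\<bar> \<le> \<bar>f y\<bar>"
      using continuous_attains_sup[OF compact_S S_nonempty, of "\<lambda>x. \<bar>f x\<bar>"] f(1)
      by (auto intro: continuous_intros)
    define s where "s = \<bar>f y\<bar>"
    have s: "s > real (Suc j) * B" using y(2)[OF x(1)] x(2) by (simp add: s_def)
    have "s > 0" using s \<open>B \<ge> 0\<close> by (meson less_le_trans mult_nonneg_nonneg not_le of_nat_0_le_iff)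
    have op: "integral_op (\<lambda>x. f x / s) x = integral_op f x / s" if "x \<in> S" for x
      using integral_op_linear[OF f(1) f(1) that, of "1 / s" 0] by simp
    show ?thesis
      unfolding Q_def
    proof (intro exI[of _ "\<lambda>x. f x / s"] conjI ballI)
      show "continuous_on S (\<lambda>x. f x / s)"
        using f(1) \<open>s > 0\<close> by (intro continuous_intros) auto
      show "(\<integral>x. f x / s * u x \<partial>P) = 0" using f(2) by simp
      show "\<bar>f x / s\<bar> \<le> 1" if "x \<in> S" for x
        using y(2)[OF that] \<open>s > 0\<close> by (simp add: s_def)
      show "\<exists>x\<in>S. \<bar>f x / s\<bar> = 1"
        using y(1) \<open>s > 0\<close> by (intro bexI[of _ y]) (auto simp: s_def)
      show "\<bar>integral_op (\<lambda>x. f x / s) x - lam * (f x / s)\<bar> \<le> 1 / real (Suc j)" if "x \<in> S" for x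
      proof -
        have "integral_op (\<lambda>x. f x / s) x - lam * (f x / s) = (integral_op f x - lam * f x) / s"
          using op[OF that] by (simp add: diff_divide_distrib)
        moreover have "\<bar>(integral_op f x - lam * f x) / s\<bar> \<le> B / s"
          using B[OF that] \<open>s > 0\<close> by (simp add: abs_divide divide_right_mono)
        moreover have "B / s \<le> 1 / real (Suc j)"
          using s \<open>s > 0\<close> by (simp add: field_simps)
        ultimately show ?thesis by linarith
      qed
    qed
  qed
  then obtain g where "\<And>j. Q j (g j)"
    by metis
  then have g: "\<And>j. continuous_on S (g j)" "\<And>j. (\<integral>x. g j x * u x \<partial>P) = 0"
      "\<And>j x. x \<in> S \<Longrightarrow> \<bar>g j x\<bar> \<le> 1" "\<And>j. \<exists>x\<in>S. \<bar>g j x\<bar> = 1"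
      "\<And>j x. x \<in> S \<Longrightarrow> \<bar>integral_op (g j) x - lam * g j x\<bar> \<le> 1 / real (Suc j)"
    unfolding Q_def by auto
  obtain H where H: "H > 0" "\<And>x y. x \<in> S \<Longrightarrow> y \<in> S \<Longrightarrow> \<bar>h x y\<bar> \<le> H"
    using kernel_bounded by blast
  obtain G r where G: "continuous_on S G" and r: "strict_mono (r :: nat \<Rightarrow> nat)"
    and lim: "\<And>e. 0 < e \<Longrightarrow> \<exists>N. \<forall>n x. n \<ge> N \<and> x \<in> S \<longrightarrow> norm (integral_op (g (r n)) x - G x) < e"
  proof (rule Arzela_Ascoli[OF compact_S, of "\<lambda>j. integral_op (g j)" H])
    show "norm (integral_op (g n) x) \<le> H" if "x \<in> S" for n x
      using integral_op_le[OF g(1) g(3) that H(2)[OF that]] by simp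
    show "\<exists>d>0. \<forall>n y. y \<in> S \<and> norm (x - y) < d \<longrightarrow> norm (integral_op (g n) x - integral_op (g n) y) < e"
      if x: "x \<in> S" and "0 < e" for x and e :: real
    proof -
      have "e / 2 > 0" using \<open>0 < e\<close> by simp
      from integral_op_equicontinuous[OF this] obtain \<delta> where "\<delta> > 0" and
        \<delta>: "\<And>f x x'. continuous_on S f \<Longrightarrow> (\<forall>y\<in>S. \<bar>f y\<bar> \<le> 1) \<Longrightarrow> x \<in> S \<Longrightarrow> x' \<in> S \<Longrightarrow>
           dist x x' < \<delta> \<Longrightarrow> \<bar>integral_op f x - integral_op f x'\<bar> \<le> e / 2 * 1"
        by blast
      have "norm (integral_op (g n) x - integral_op (g n) y) < e"
        if "y \<in> S" "norm (x - y) < \<delta>" for n y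
        using \<delta>[OF g(1), of n x y] g(3) x that \<open>0 < e\<close> by (auto simp: dist_norm)
      with \<open>\<delta> > 0\<close> show ?thesis by blast
    qed
  qed (use that in blast)
  define q where "q x = G x / lam" for x
  have q: "continuous_on S q"
    unfolding q_def using G lam_nonzero by (intro continuous_intros) auto
  have conv: "\<exists>n. \<forall>x\<in>S. \<bar>integral_op (g (r n)) x - G x\<bar> \<le> e \<and> \<bar>g (r n) x - q x\<bar> \<le> e"
    if "e > 0" for e
  proof -
    \<comment> \<open>The distance of \<open>lam * g\<close> to G collects two errors of size e',
      one from the limit and one from the residual; dividing by \<open>lam\<close> must leave at
      most e.\<close>
    define e' where "e' = min e (\<bar>lam\<bar> * e / 2)"
    have "e' > 0" using that lam_nonzero by (simp add: e'_def)
    from lim[OF this] obtain N where N: "\<And>n x. n \<ge> N \<Longrightarrow> x \<in> S \<Longrightarrow> \<bar>integral_op (g (r n)) x - G x\<bar> < e'"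
      by auto
    obtain m where m: "1 / real (Suc m) < e'"
      using \<open>e' > 0\<close> nat_approx_posE by blast
    let ?n = "max N m"
    have rn: "1 / real (Suc (r ?n)) \<le> e'"
    proof -
      have "m \<le> r ?n" using seq_suble[OF r, of ?n] by linarith
      then have "1 / real (Suc (r ?n)) \<le> 1 / real (Suc m)" by (intro divide_left_mono) auto
      with m show ?thesis by linarith
    qed
    have "\<bar>integral_op (g (r ?n)) x - G x\<bar> \<le> e \<and> \<bar>g (r ?n) x - q x\<bar> \<le> e" if x: "x \<in> S" for x
    proof
      have 1: "\<bar>integral_op (g (r ?n)) x - G x\<bar> < e'" using N[of ?n x] x by simp
      then show "\<bar>integral_op (g (r ?n)) x - G x\<bar> \<le> e" by (simp add: e'_def)
      have "\<bar>lam * g (r ?n) x - G x\<bar> \<le> 2 * e'"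
        using 1 g(5)[OF x, of "r ?n"] rn by linarith
      also have "\<dots> \<le> \<bar>lam\<bar> * e" by (simp add: e'_def)
      also have "lam * g (r ?n) x - G x = lam * (g (r ?n) x - q x)"
        using lam_nonzero by (simp add: q_def right_diff_distrib)
      finally show "\<bar>g (r ?n) x - q x\<bar> \<le> e"
        using lam_nonzero by (simp add: abs_mult)
    qed
    then show ?thesis by blast
  qed
  have "integral_op q x = lam * q x" if x: "x \<in> S" for x
  proof -
    \<comment> \<open>The summand 0 gives the shape required by
      \<open>field_le_epsilon\<close>.\<close>
    have "\<bar>integral_op q x - G x\<bar> \<le> 0 + e" if "e > 0" for e
    proof -
      \<comment> \<open>Replacing g by q under the operator costs H * e', and the convergence to G
        costs another e'.\<close>
      define e' where "e' = e / (H + 1)"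
      have "(H + 1) * e' = e" using H(1) by (simp add: e'_def)
      then have e': "H * e' + e' = e" by (simp add: distrib_right)
      have "e' > 0" using \<open>e > 0\<close> H(1) by (simp add: e'_def)
      from conv[OF this] obtain n where n: "\<And>x. x \<in> S \<Longrightarrow> \<bar>integral_op (g (r n)) x - G x\<bar> \<le> e'"
        "\<And>x. x \<in> S \<Longrightarrow> \<bar>g (r n) x - q x\<bar> \<le> e'" by blast
      have "\<bar>integral_op (\<lambda>x. g (r n) x - q x) x\<bar> \<le> H * e'"
        using g(1) q n(2) x H(2) by (intro integral_op_le) (auto intro!: continuous_intros)
      also have "integral_op (\<lambda>x. g (r n) x - q x) x = integral_op (g (r n)) x - integral_op q x"
        using integral_op_linear[OF g(1)[of "r n"] q x, of 1 "-1"] by simp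
      finally show ?thesis using n(1)[OF x] e' by linarith
    qed
    then have "\<bar>integral_op q x - G x\<bar> \<le> 0" by (rule field_le_epsilon)
    then show ?thesis using lam_nonzero by (simp add: q_def)
  qed
  then obtain c where c: "\<And>x. x \<in> S \<Longrightarrow> q x = c * u x"
    using eigenspace[OF q] by blast
  have "\<bar>\<integral>x. q x * u x \<partial>P\<bar> \<le> 0 + e" if "e > 0" for e
  proof -
    from conv[OF that] obtain n where n: "\<And>x. x \<in> S \<Longrightarrow> \<bar>g (r n) x - q x\<bar> \<le> e" by blast
    have "\<bar>\<integral>x. (g (r n) x - q x) * u x \<partial>P\<bar> \<le> e * 1"
    proof (rule abs_integral_le)
      show "continuous_on S (\<lambda>x. (g (r n) x - q x) * u x)"
        by (intro continuous_intros g q continuous_u)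
      show "\<bar>(g (r n) x - q x) * u x\<bar> \<le> e * 1" if "x \<in> S" for x
        unfolding abs_mult using n u_le_1 that \<open>e > 0\<close> by (intro mult_mono) auto
    qed
    moreover have "(\<integral>x. (g (r n) x - q x) * u x \<partial>P) = (\<integral>x. g (r n) x * u x \<partial>P) - (\<integral>x. q x * u x \<partial>P)"
      unfolding left_diff_distrib
      by (intro Bochner_Integration.integral_diff continuous_integrable continuous_intros g q continuous_u)
    ultimately show ?thesis using g(2) by simp
  qed
  then have "\<bar>\<integral>x. q x * u x \<partial>P\<bar> \<le> 0" by (rule field_le_epsilon)
  moreover have "(\<integral>x. q x * u x \<partial>P) = (\<integral>x. c * (u x * u x) \<partial>P)"
    using c by (intro Bochner_Integration.integral_cong) (auto simp: space_P)
  ultimately have "c = 0"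
    using integral_u_square_pos by simp
  \<comment> \<open>Now q vanishes on S, so any accuracy below 1 contradicts the point where |g| =
    1.\<close>
  have "(1 / 2 :: real) > 0" by simp
  from conv[OF this] obtain n where n: "\<And>x. x \<in> S \<Longrightarrow> \<bar>g (r n) x - q x\<bar> \<le> 1 / 2" by blast
  obtain x where x: "x \<in> S" "\<bar>g (r n) x\<bar> = 1"
    using g(4) by blast
  show False
    using n[OF x(1)] c[OF x(1)] \<open>c = 0\<close> x(2) by simp
qed

text \<open>Write f = \<alpha> u + v with v orthogonal to u. Coercivity bounds v by \<eta> and
  |\<mu> - lam| together; as both are at most \<epsilon>, v is small and |\<alpha>| stays away from
  0. Only then does pairing the residual with u give |\<mu> - lam| = O(\<eta>), and returning this
  to the bound on v makes v = O(\<eta>). Thus \<epsilon> fixes a neighbourhood and does not enter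
  the rate.\<close>

lemma approximate_eigenfunction_stability:
  "\<exists>K>0. \<exists>\<epsilon>>0. \<forall>f \<mu> \<eta>. continuous_on S f \<longrightarrow> (\<forall>x\<in>S. \<bar>f x\<bar> \<le> 1) \<longrightarrow> (\<exists>x\<in>S. \<bar>f x\<bar> = 1) \<longrightarrow>
     (\<forall>x\<in>S. \<bar>integral_op f x - \<mu> * f x\<bar> \<le> \<eta>) \<longrightarrow> \<eta> \<le> \<epsilon> \<longrightarrow> \<bar>\<mu> - lam\<bar> \<le> \<epsilon> \<longrightarrow>
     (\<forall>x\<in>S. \<bar>(if f x\<^sub>0 * u x\<^sub>0 \<ge> 0 then 1 else -1) * f x - u x\<bar> \<le> K * \<eta>)"
proof -
  obtain K where K: "K > 0" and coercive: "\<And>f B x. continuous_on S f \<Longrightarrow> (\<integral>x. f x * u x \<partial>P) = 0 \<Longrightarrow>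
     (\<forall>x\<in>S. \<bar>integral_op f x - lam * f x\<bar> \<le> B) \<Longrightarrow> x \<in> S \<Longrightarrow> \<bar>f x\<bar> \<le> K * B"
    using coercive_on_complement by blast
  define N where "N = (\<integral>y. u y * u y \<partial>P)"
  have N: "N > 0" using integral_u_square_pos by (simp add: N_def)
  \<comment> \<open>Chosen so that K * (2 * \<epsilon>) = 1/4, the first bound on v.\<close>
  define \<epsilon> where "\<epsilon> = 1 / (8 * K)"
  \<comment> \<open>Half of \<open>L * \<eta>\<close> bounds v, after inserting |\<mu> - lam| \<le>
    2 \<eta> / N; the other half bounds the error of |\<alpha>| against 1.\<close>
  define L where "L = 2 * (K * (1 + 2 / N))"
  have main: "\<bar>(if f x\<^sub>0 * u x\<^sub>0 \<ge> 0 then 1 else -1) * f x - u x\<bar> \<le> L * \<eta>"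
    if f: "continuous_on S f" and f1: "\<forall>x\<in>S. \<bar>f x\<bar> \<le> 1" and f2: "\<exists>x\<in>S. \<bar>f x\<bar> = 1"
      and \<eta>: "\<forall>x\<in>S. \<bar>integral_op f x - \<mu> * f x\<bar> \<le> \<eta>" and small: "\<eta> \<le> \<epsilon>" "\<bar>\<mu> - lam\<bar> \<le> \<epsilon>"
      and x: "x \<in> S" for f \<mu> \<eta> x
  proof -
    define \<alpha> where "\<alpha> = (\<integral>y. f y * u y \<partial>P) / N"
    \<comment> \<open>Written in the literal shape of \<open>integral_op_linear\<close>.\<close>
    define v where "v = (\<lambda>y. 1 * f y + (- \<alpha>) * u y)"
    have v: "continuous_on S v"
      unfolding v_def by (intro continuous_intros f continuous_u)
    have fv: "f y = \<alpha> * u y + v y" for y by (simp add: v_def)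
    have int_fu: "integrable P (\<lambda>y. f y * u y)" and int_uu: "integrable P (\<lambda>y. u y * u y)"
      by (intro continuous_integrable continuous_intros f continuous_u)+
    have v_orth: "(\<integral>y. v y * u y \<partial>P) = 0"
    proof -
      have "(\<integral>y. v y * u y \<partial>P) = (\<integral>y. f y * u y - \<alpha> * (u y * u y) \<partial>P)"
        by (intro Bochner_Integration.integral_cong) (auto simp: v_def algebra_simps)
      also have "\<dots> = (\<integral>y. f y * u y \<partial>P) - \<alpha> * N"
        using int_fu int_uu by (simp add: N_def)
      finally show ?thesis using N by (simp add: \<alpha>_def)
    qed
    have v_bound: "\<bar>v y\<bar> \<le> K * (\<eta> + \<bar>\<mu> - lam\<bar>)" if "y \<in> S" for y
    proof (rule coercive[OF v v_orth _ that], intro ballI)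
      fix y assume y: "y \<in> S"
      have "integral_op v y - lam * v y = (integral_op f y - \<mu> * f y) + (\<mu> - lam) * f y"
        unfolding v_def integral_op_linear[OF f continuous_u y] u_eigen[OF y]
        by (simp add: algebra_simps)
      moreover have "\<bar>(\<mu> - lam) * f y\<bar> \<le> \<bar>\<mu> - lam\<bar>"
        unfolding abs_mult using f1 y by (intro mult_left_le) auto
      moreover have "\<bar>integral_op f y - \<mu> * f y\<bar> \<le> \<eta>" using \<eta> y by blast
      ultimately show "\<bar>integral_op v y - lam * v y\<bar> \<le> \<eta> + \<bar>\<mu> - lam\<bar>"
        by (auto intro: order.trans[OF abs_triangle_ineq add_mono])
    qed
    have "\<eta> \<ge> 0" using bspec[OF \<eta> x] by linarith
    have "K * (\<eta> + \<bar>\<mu> - lam\<bar>) \<le> K * (2 * \<epsilon>)"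
      using small K by (intro mult_left_mono) auto
    also have "\<dots> = 1 / 4" using K by (simp add: \<epsilon>_def)
    finally have v_small: "\<bar>v y\<bar> \<le> 1 / 4" if "y \<in> S" for y
      using v_bound[OF that] by linarith
    \<comment> \<open>Evaluate at a point where |f| = 1. With b = 1/4 this keeps \<alpha> away from
      0; with the refined bound on v it is the lower half of the estimate of |\<alpha>| - 1.\<close>
    have abs_\<alpha>: "1 \<le> \<bar>\<alpha>\<bar> + b" if b: "\<And>y. y \<in> S \<Longrightarrow> \<bar>v y\<bar> \<le> b" for b
    proof -
      obtain y where y: "y \<in> S" "\<bar>f y\<bar> = 1" using f2 by blast
      have "\<bar>\<alpha> * u y\<bar> \<le> \<bar>\<alpha>\<bar> * 1"
        unfolding abs_mult using u_le_1[OF y(1)] by (intro mult_left_mono) auto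
      then show ?thesis using fv[of y] b[OF y(1)] y(2) by linarith
    qed
    have \<alpha>_large: "\<bar>\<alpha>\<bar> \<ge> 3 / 4" using abs_\<alpha>[OF v_small] by simp
    have "(\<integral>y. (integral_op f y - \<mu> * f y) * u y \<partial>P) = (lam - \<mu>) * (\<alpha> * N)"
    proof -
      have int1: "integrable P (\<lambda>y. integral_op f y * u y)"
        by (intro continuous_integrable continuous_intros integral_op_continuous f continuous_u)
      have "(\<integral>y. (integral_op f y - \<mu> * f y) * u y \<partial>P) =
          (\<integral>y. integral_op f y * u y - \<mu> * (f y * u y) \<partial>P)"
        by (intro Bochner_Integration.integral_cong) (auto simp: algebra_simps)
      also have "\<dots> = (\<integral>y. integral_op f y * u y \<partial>P) - \<mu> * (\<integral>y. f y * u y \<partial>P)"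
        using int1 int_fu by simp
      also have "(\<integral>y. integral_op f y * u y \<partial>P) = (\<integral>y. f y * integral_op u y \<partial>P)"
        by (rule integral_op_self_adjoint[OF f continuous_u])
      also have "\<dots> = (\<integral>y. lam * (f y * u y) \<partial>P)"
        using u_eigen by (intro Bochner_Integration.integral_cong) (auto simp: space_P)
      finally show ?thesis using N by (simp add: \<alpha>_def algebra_simps)
    qed
    moreover have "\<bar>\<integral>y. (integral_op f y - \<mu> * f y) * u y \<partial>P\<bar> \<le> \<eta> * 1"
    proof (rule abs_integral_le)
      show "continuous_on S (\<lambda>y. (integral_op f y - \<mu> * f y) * u y)"
        by (intro continuous_intros integral_op_continuous f continuous_u)
      show "\<bar>(integral_op f y - \<mu> * f y) * u y\<bar> \<le> \<eta> * 1" if "y \<in> S" for y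
        unfolding abs_mult using \<eta> u_le_1 that \<open>\<eta> \<ge> 0\<close> by (intro mult_mono) auto
    qed
    ultimately have "\<bar>\<mu> - lam\<bar> * \<bar>\<alpha>\<bar> * N \<le> \<eta>"
      using N by (simp add: abs_mult abs_minus_commute mult_ac)
    moreover have "\<bar>\<mu> - lam\<bar> * (1 / 2) * N \<le> \<bar>\<mu> - lam\<bar> * \<bar>\<alpha>\<bar> * N"
      using \<alpha>_large N by (intro mult_right_mono mult_left_mono) auto
    ultimately have "\<bar>\<mu> - lam\<bar> * (1 / 2) * N \<le> \<eta>" by linarith
    then have "\<bar>\<mu> - lam\<bar> \<le> 2 / N * \<eta>"
      using N by (simp add: field_simps)
    then have "K * (\<eta> + \<bar>\<mu> - lam\<bar>) \<le> K * (\<eta> + 2 / N * \<eta>)"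
      using K by (intro mult_left_mono) auto
    also have "\<dots> = L * \<eta> / 2" by (simp add: L_def algebra_simps)
    finally have v_le: "\<bar>v y\<bar> \<le> L * \<eta> / 2" if "y \<in> S" for y
      using v_bound[OF that] by linarith
    define s :: real where "s = (if f x\<^sub>0 * u x\<^sub>0 \<ge> 0 then 1 else -1)"
    \<comment> \<open>At \<open>x\<^sub>0\<close> the square of u is 1, so f * u differs there from
      \<alpha> by at most 1/4. As |\<alpha>| is at least 3/4, the sign of f * u at this single point
      is the sign of \<alpha>.\<close>
    have "\<bar>v x\<^sub>0 * u x\<^sub>0\<bar> \<le> 1 / 4"
      using v_small x\<^sub>0 by (simp add: abs_mult)
    moreover have "f x\<^sub>0 * u x\<^sub>0 = \<alpha> + v x\<^sub>0 * u x\<^sub>0"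
    proof -
      have "u x\<^sub>0 * u x\<^sub>0 = 1" using x\<^sub>0(2) by (metis abs_mult_self_eq mult_1)
      then show ?thesis by (simp add: fv algebra_simps)
    qed
    ultimately have s\<alpha>: "s * \<alpha> = \<bar>\<alpha>\<bar>"
      using \<alpha>_large by (auto simp: s_def)
    have s1: "\<bar>s\<bar> = 1" by (simp add: s_def)
    \<comment> \<open>The upper half, again at \<open>x\<^sub>0\<close>: there |\<alpha> u| =
      |\<alpha>| while |f| is at most 1.\<close>
    have "\<bar>\<alpha>\<bar> \<le> 1 + L * \<eta> / 2"
    proof -
      have "\<bar>\<alpha> * u x\<^sub>0\<bar> = \<bar>\<alpha>\<bar>" using x\<^sub>0 by (simp add: abs_mult)
      then show ?thesis using fv[of x\<^sub>0] bspec[OF f1 x\<^sub>0(1)] v_le[OF x\<^sub>0(1)] by linarith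
    qed
    moreover have "1 \<le> \<bar>\<alpha>\<bar> + L * \<eta> / 2" by (rule abs_\<alpha>[OF v_le])
    ultimately have "\<bar>\<bar>\<alpha>\<bar> - 1\<bar> \<le> L * \<eta> / 2" by linarith
    moreover have "\<bar>(\<bar>\<alpha>\<bar> - 1) * u x\<bar> \<le> \<bar>\<bar>\<alpha>\<bar> - 1\<bar>"
      unfolding abs_mult using u_le_1[OF x] by (intro mult_left_le) auto
    ultimately have "\<bar>(\<bar>\<alpha>\<bar> - 1) * u x\<bar> \<le> L * \<eta> / 2"
      by (rule order.trans[rotated])
    moreover have "\<bar>s * v x\<bar> \<le> L * \<eta> / 2" using v_le[OF x] s1 by (simp add: abs_mult)
    moreover have "s * f x - u x = (\<bar>\<alpha>\<bar> - 1) * u x + s * v x"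
      unfolding fv[of x] s\<alpha>[symmetric] by (simp add: algebra_simps)
    ultimately have "\<bar>s * f x - u x\<bar> \<le> L * \<eta>" by linarith
    then show ?thesis by (simp add: s_def)
  qed
  have "L > 0" "\<epsilon> > 0" using K N by (auto simp: L_def \<epsilon>_def intro!: mult_pos_pos add_pos_pos)
  then show ?thesis
    by - (rule exI[of _ L], rule conjI, assumption, rule exI[of _ \<epsilon>], rule conjI, assumption,
        intro allI impI ballI, rule main)
qed

end

section \<open>The normalized Gaussian operator and its empirical version\<close>

lemma gauss_kernel_commute: "gauss_kernel \<sigma> x y = gauss_kernel \<sigma> y x"
  by (simp add: gauss_kernel_def norm_minus_commute)

lemma gauss_kernel_pos: "gauss_kernel \<sigma> x y > 0"
  by (simp add: gauss_kernel_def)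

lemma gauss_kernel_le_1: "gauss_kernel \<sigma> x y \<le> 1"
  by (simp add: gauss_kernel_def)

lemma gauss_kernel_ge:
  assumes "norm x \<le> R" "norm y \<le> R"
  shows "exp (- (2 * R)\<^sup>2 / \<sigma>\<^sup>2) \<le> gauss_kernel \<sigma> x y"
proof -
  have "norm (x - y) \<le> 2 * R"
    using norm_triangle_ineq4[of x y] assms by linarith
  then have "(norm (x - y))\<^sup>2 \<le> (2 * R)\<^sup>2"
    by (intro power_mono) auto
  then show ?thesis
    unfolding gauss_kernel_def by (auto intro!: divide_right_mono)
qed

lemma gauss_kernel_factor:
  fixes x y :: "'a::real_inner"
  shows "gauss_kernel \<sigma> x y =
    exp (- (norm x)\<^sup>2 / \<sigma>\<^sup>2) * (exp (((2 / \<sigma>\<^sup>2) *\<^sub>R x) \<bullet> y) * exp (- (norm y)\<^sup>2 / \<sigma>\<^sup>2))"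
proof -
  have "(norm (x - y))\<^sup>2 = (norm x)\<^sup>2 - 2 * (x \<bullet> y) + (norm y)\<^sup>2"
    by (simp add: power2_norm_eq_inner inner_diff_left inner_diff_right inner_commute)
  then show ?thesis
    by (simp add: gauss_kernel_def exp_add[symmetric] add_divide_distrib diff_divide_distrib)
qed

text \<open>The empirical measure is the image of the uniform measure on \<open>{1..n}\<close> under
  the sample path, which reduces the integral to a finite average.\<close>

lemma integral_empirical_measure:
  fixes f :: "'a \<Rightarrow> real"
  assumes "n \<ge> 1" and x: "\<And>i. i \<ge> 1 \<Longrightarrow> x i \<in> space P" and f: "f \<in> borel_measurable P"
  shows "(\<integral>y. f y \<partial>empirical_measure P x n) = (\<Sum>i=1..n. f (x i)) / real n"
proof -
  let ?U = "uniform_count_measure {1..n}"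
  have x_meas: "x \<in> ?U \<rightarrow>\<^sub>M P"
    using x by (auto simp: measurable_def space_uniform_count_measure sets_uniform_count_measure)
  have "empirical_measure P x n = distr ?U P x"
  proof (rule measure_eqI)
    fix A assume "A \<in> sets (empirical_measure P x n)"
    then have A: "A \<in> sets P" by simp
    have "emeasure (distr ?U P x) A = emeasure ?U (x -` A \<inter> {1..n})"
      using emeasure_distr[OF x_meas A] by (simp add: space_uniform_count_measure)
    also have "\<dots> = ennreal (real (card (x -` A \<inter> {1..n})) / real n)"
      by (subst emeasure_uniform_count_measure) auto
    also have "real (card (x -` A \<inter> {1..n})) = (\<Sum>i=1..n. indicator A (x i))"
      by (simp add: indicator_def sum.If_cases) (simp add: vimage_def Int_def conj_commute)
    also have "ennreal ((\<Sum>i=1..n. indicator A (x i)) / real n) =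
        ennreal (1 / real n) * ennreal (\<Sum>i=1..n. indicator A (x i))"
      by (subst ennreal_mult[symmetric]) (auto intro: sum_nonneg)
    also have "ennreal (\<Sum>i=1..n. indicator A (x i)) = (\<Sum>i=1..n. emeasure (return P (x i)) A)"
      using A by (subst sum_ennreal[symmetric]) (auto simp: indicator_def ennreal_of_nat_eq_real_of_nat)
    finally show "emeasure (empirical_measure P x n) A = emeasure (distr ?U P x) A"
      using emeasure_empirical_measure[OF A] by simp
  qed simp
  then show ?thesis
    using f x_meas \<open>n \<ge> 1\<close> by (simp add: integral_distr integral_uniform_count_measure)
qed

text \<open>The difference is (b - a) over sqrt a * sqrt b * (sqrt a + sqrt b). As c \<le> 1 gives c
  \<le> sqrt a, both the product of the roots and their sum are at least c; this is cruder than
  c^(3/2) but keeps integer powers.\<close>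

lemma inverse_sqrt_diff_le:
  fixes a b c :: real
  assumes "0 < c" "c \<le> 1" "c \<le> a" "c \<le> b"
  shows "\<bar>1 / sqrt a - 1 / sqrt b\<bar> \<le> \<bar>a - b\<bar> / c\<^sup>2"
proof -
  have s: "c \<le> sqrt a" "c \<le> sqrt b"
  proof -
    have "c\<^sup>2 \<le> c" using assms by (simp add: power2_eq_square mult_left_le)
    then show "c \<le> sqrt a" "c \<le> sqrt b" using assms by (auto intro: real_le_rsqrt)
  qed
  have "sqrt a > 0" "sqrt b > 0" using assms by auto
  have *: "1 / sqrt a - 1 / sqrt b = (b - a) / (sqrt a * sqrt b * (sqrt a + sqrt b))"
  proof -
    have ba: "b - a = (sqrt b - sqrt a) * (sqrt a + sqrt b)"
      using assms by (simp add: algebra_simps)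
    have "1 / sqrt a - 1 / sqrt b = (sqrt b - sqrt a) / (sqrt a * sqrt b)"
      using \<open>sqrt a > 0\<close> \<open>sqrt b > 0\<close> by (simp add: diff_divide_distrib)
    then show ?thesis
      unfolding ba using add_pos_pos[OF \<open>sqrt a > 0\<close> \<open>sqrt b > 0\<close>] by simp
  qed
  have "c\<^sup>2 \<le> sqrt a * sqrt b * (sqrt a + sqrt b)"
  proof -
    have "c \<le> sqrt a * sqrt b"
    proof -
      have "sqrt c * sqrt c \<le> sqrt a * sqrt b" using assms by (intro mult_mono) auto
      then show ?thesis using assms by simp
    qed
    moreover have "c \<le> sqrt a + sqrt b" using s assms by linarith
    ultimately show ?thesis
      unfolding power2_eq_square using assms by (intro mult_mono) auto
  qed
  then show ?thesis
    unfolding * abs_divide using assms \<open>sqrt a > 0\<close> \<open>sqrt b > 0\<close>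
    by (auto simp: abs_mult abs_minus_commute intro!: frac_le)
qed

section \<open>The Gaussian operator on a compact set\<close>

locale gauss_operator = prob_space P
  for P :: "'a::euclidean_space measure" +
  fixes S :: "'a set" and \<sigma> R :: real
  assumes compact_S: "compact S" and \<sigma>_pos: "\<sigma> > 0"
    and sets_P: "sets P = sets (restrict_space borel S)"
    and support_P: "measure_support P = S"
    and norm_S: "\<And>x. x \<in> S \<Longrightarrow> norm x \<le> R"
begin

abbreviation "k \<equiv> gauss_kernel \<sigma>"
abbreviation "d \<equiv> kernel_degree k P"

sublocale gauss: continuous_kernel P S k
proof
  show "continuous_on (S \<times> S) (\<lambda>(x, y). k x y)"
    using \<sigma>_pos unfolding gauss_kernel_def case_prod_beta by (intro continuous_intros) auto
  show "k x y = k y x" for x y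
    by (rule gauss_kernel_commute)
qed (fact compact_S sets_P support_P)+

text \<open>A lower bound of the kernel on S, because two points of S are at most 2 R apart.
  Averaging passes it on to d and to every empirical degree, so the normalizations never
  degenerate.\<close>

definition c where "c = exp (- (2 * R)\<^sup>2 / \<sigma>\<^sup>2)"

lemma c_bounds: "0 < c" "c \<le> 1"
  by (auto simp: c_def)

lemma k_bounds: "x \<in> S \<Longrightarrow> y \<in> S \<Longrightarrow> c \<le> k x y" "0 \<le> k x y" "k x y \<le> 1"
  unfolding c_def
  by (rule gauss_kernel_ge norm_S gauss_kernel_le_1 less_imp_le[OF gauss_kernel_pos] | assumption)+

lemma k_measurable: "x \<in> S \<Longrightarrow> k x \<in> borel_measurable P"
  by (intro gauss.continuous_imp_measurable gauss.kernel_section_continuous)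

lemma d_continuous: "continuous_on S d"
  using gauss.integral_op_continuous[OF continuous_on_const[of S 1]]
  by (simp add: gauss.integral_op_def[abs_def] kernel_degree_def[abs_def])

lemma d_bounds:
  assumes "x \<in> S"
  shows "c \<le> d x" "d x \<le> 1"
proof -
  have int: "integrable P (k x)"
    by (intro gauss.continuous_integrable gauss.kernel_section_continuous assms)
  have "(\<integral>y. c \<partial>P) \<le> d x"
    unfolding kernel_degree_def using int k_bounds assms
    by (intro integral_mono) (auto simp: gauss.space_P)
  then show "c \<le> d x" by (simp add: prob_space)
  have "d x \<le> (\<integral>y. 1 \<partial>P)"
    unfolding kernel_degree_def using int k_bounds assms
    by (intro integral_mono) (auto simp: gauss.space_P)
  then show "d x \<le> 1" by (simp add: prob_space)
qed

lemma d_pos: "x \<in> S \<Longrightarrow> 0 < d x"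
  using d_bounds(1) c_bounds(1) by (rule less_le_trans[rotated])

sublocale normalized: continuous_kernel P S "normalized_kernel k P"
proof
  show "continuous_on (S \<times> S) (\<lambda>(x, y). normalized_kernel k P x y)"
    unfolding normalized_kernel_def case_prod_beta
  proof (intro continuous_intros)
    show "continuous_on (S \<times> S) (\<lambda>p. k (fst p) (snd p))"
      using gauss.continuous_h by (simp add: case_prod_beta')
    show "continuous_on (S \<times> S) (\<lambda>p. d (fst p))" "continuous_on (S \<times> S) (\<lambda>p. d (snd p))"
      by (auto intro!: continuous_on_compose2[OF d_continuous] continuous_intros)
    show "\<forall>p\<in>S \<times> S. sqrt (d (fst p) * d (snd p)) \<noteq> 0"
      by (auto dest!: d_pos)
  qed
  show "normalized_kernel k P x y = normalized_kernel k P y x" for x y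
    by (simp add: normalized_kernel_def gauss_kernel_commute[of _ x y] mult.commute)
qed (fact compact_S sets_P support_P)+

lemma normalized_operator_eq:
  "normalized_operator k P f x = (if x \<in> S then normalized.integral_op f x else 0)"
  by (simp add: normalized_operator_def normalized.integral_op_def gauss.space_P)

lemma normalized_kernel_eq:
  assumes "x \<in> S" "y \<in> S"
  shows "normalized_kernel k P x y = (1 / sqrt (d x)) * (1 / sqrt (d y)) * k x y"
  by (simp add: normalized_kernel_def real_sqrt_mult)

text \<open>
  The residual is \<open>(T - T\<^sub>n) f\<close>, which is not small for general \<open>f\<close>. The eigenvalue equation makes
  \<open>f\<close> an average of kernel sections \<open>k(\<cdot>, X\<^sub>i)\<close>, and this reduces the residual to deviations of
  the two fixed classes in the hypotheses.
\<close>

lemma empirical_eigenfunction_residual: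
  fixes x :: "nat \<Rightarrow> 'a" and n :: nat
  defines "Q \<equiv> empirical_measure P x n"
  assumes "n \<ge> 1" and x: "\<And>i. i \<ge> 1 \<Longrightarrow> x i \<in> S"
    and f: "continuous_on S f" "\<And>z. z \<in> S \<Longrightarrow> \<bar>f z\<bar> \<le> 1"
    and eigen: "\<And>z. z \<in> S \<Longrightarrow> normalized_operator k Q f z = \<mu> * f z"
    and m: "0 < m" "m \<le> \<bar>\<mu>\<bar>"
    and e1: "\<And>z. z \<in> S \<Longrightarrow> \<bar>deviation P x n (k z)\<bar> \<le> e"
    and e2: "\<And>z w. z \<in> S \<Longrightarrow> w \<in> S \<Longrightarrow> \<bar>deviation P x n (\<lambda>y. k z y * k y w / d y)\<bar> \<le> e"
    and z: "z \<in> S"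
  shows "\<bar>normalized.integral_op f z - \<mu> * f z\<bar> \<le> (2 / (c ^ 5 * m) + 2 / c ^ 3 + 1 / (c\<^sup>2 * m)) * e"
proof -
  \<comment> \<open>A common bound for 1/sqrt d and 1/sqrt d_n on S.\<close>
  define q where "q = 1 / c"
  have q: "q \<ge> 1" "q > 0" using c_bounds by (auto simp: q_def)
  have "\<mu> \<noteq> 0" using m by auto
  have "e \<ge> 0" using e1[OF z] by linarith
  define dn where "dn = kernel_degree k Q"
  define r where "r y = 1 / sqrt (d y)" for y
  define rn where "rn y = 1 / sqrt (dn y)" for y
  have x': "\<And>i. i \<ge> 1 \<Longrightarrow> x i \<in> space P" using x by (simp add: gauss.space_P)
  note f_meas = gauss.continuous_imp_measurable[OF f(1)]
  have dn_eq: "dn y = (\<Sum>i=1..n. k y (x i)) / real n" if "y \<in> S" for y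
    unfolding dn_def Q_def kernel_degree_def
    using integral_empirical_measure[OF \<open>n \<ge> 1\<close> x' k_measurable[OF that]] .
  have k_col_cont: "continuous_on S (\<lambda>y. k y (x i))" if "i \<in> {1..n}" for i
    unfolding gauss_kernel_commute[of _ _ "x i"]
    using gauss.kernel_section_continuous[of "x i"] x that by auto
  have avg_le: "\<bar>(\<Sum>i=1..n. g i) / real n\<bar> \<le> B" if "\<And>i. i \<in> {1..n} \<Longrightarrow> \<bar>g i\<bar> \<le> B" for g B
  proof -
    have "\<bar>\<Sum>i=1..n. g i\<bar> \<le> real (card {1..n}) * B"
      using that by (intro order.trans[OF sum_abs] sum_bounded_above) auto
    then show ?thesis
      using \<open>n \<ge> 1\<close> by (simp only: abs_divide) (simp add: field_simps)
  qed
  have dn_ge: "c \<le> dn y" if "y \<in> S" for y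
  proof -
    have "real (card {1..n}) * c \<le> (\<Sum>i=1..n. k y (x i))"
      using that x k_bounds by (intro sum_bounded_below) auto
    then show ?thesis
      unfolding dn_eq[OF that] using \<open>n \<ge> 1\<close> by (simp add: field_simps)
  qed
  then have dn_pos: "0 < dn y" if "y \<in> S" for y
    using c_bounds(1) that by (meson less_le_trans)
  have dn_d: "\<bar>dn y - d y\<bar> \<le> e" if "y \<in> S" for y
    using e1[OF that] unfolding dn_eq[OF that] deviation_def kernel_degree_def .
  have inv_le_q: "0 \<le> 1 / sqrt a" "1 / sqrt a \<le> q" if "c \<le> a" for a
  proof -
    have "c\<^sup>2 \<le> c" using c_bounds by (simp add: power2_eq_square mult_left_le)
    then have "c \<le> sqrt a" using that by (intro real_le_rsqrt) linarith
    then show "0 \<le> 1 / sqrt a" "1 / sqrt a \<le> q"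
      using c_bounds that by (auto simp: q_def intro!: frac_le)
  qed
  have r: "0 \<le> r y" "r y \<le> q" if "y \<in> S" for y
    using inv_le_q[OF d_bounds(1)[OF that]] by (auto simp: r_def)
  have rn: "0 \<le> rn y" "rn y \<le> q" if "y \<in> S" for y
    using inv_le_q[OF dn_ge[OF that]] by (auto simp: rn_def)
  have rn_r: "\<bar>rn y - r y\<bar> \<le> q\<^sup>2 * e" if "y \<in> S" for y
  proof -
    have "\<bar>rn y - r y\<bar> \<le> \<bar>dn y - d y\<bar> / c\<^sup>2"
      unfolding rn_def r_def using c_bounds dn_ge[OF that] d_bounds(1)[OF that]
      by (intro inverse_sqrt_diff_le)
    also have "\<dots> \<le> e / c\<^sup>2" using dn_d[OF that] by (intro divide_right_mono) auto
    finally show ?thesis by (simp add: q_def power_divide)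
  qed
  have r_cont: "continuous_on S r"
    unfolding r_def by (intro continuous_intros d_continuous) (auto dest: d_pos)
  \<comment> \<open>This is h(z, y) with its degree factors split off, so that each exchange of
    \<open>r\<close> and \<open>rn\<close> can be estimated separately.\<close>
  define hf where "hf y = r z * r y * k z y" for y
  have hf_eq: "normalized_kernel k P z y = hf y" if "y \<in> S" for y
    using normalized_kernel_eq[OF z that] by (simp add: hf_def r_def)
  have hf_cont: "continuous_on S hf"
    unfolding hf_def using z
    by (intro continuous_intros r_cont gauss.kernel_section_continuous)
  have hf_bound: "\<bar>hf y\<bar> \<le> q\<^sup>2" if "y \<in> S" for y
  proof -
    have "r z * r y * k z y \<le> q * q * 1"
      using r[OF z] r[OF that] k_bounds q by (intro mult_mono) auto
    moreover have "0 \<le> r z * r y * k z y"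
      using r[OF z] r[OF that] k_bounds by simp
    ultimately show ?thesis by (simp add: hf_def power2_eq_square)
  qed
  define a where "a i = rn (x i) * f (x i)" for i
  have a_bound: "\<bar>a i\<bar> \<le> q" if "i \<in> {1..n}" for i
  proof -
    have "x i \<in> S" using x that by auto
    then have "\<bar>rn (x i)\<bar> * \<bar>f (x i)\<bar> \<le> q * 1"
      using rn f(2) q by (intro mult_mono) auto
    then show ?thesis by (simp add: a_def abs_mult)
  qed
  define A where "A y = (\<Sum>i=1..n. k y (x i) * a i) / real n" for y
  have A_bound: "\<bar>A y\<bar> \<le> q" for y
    unfolding A_def
  proof (rule avg_le)
    fix i assume "i \<in> {1..n}"
    then have "\<bar>k y (x i)\<bar> * \<bar>a i\<bar> \<le> 1 * q"
      using a_bound k_bounds by (intro mult_mono) auto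
    then show "\<bar>k y (x i) * a i\<bar> \<le> q" by (simp add: abs_mult)
  qed
  have A_cont: "continuous_on S A"
    unfolding A_def using k_col_cont \<open>n \<ge> 1\<close> by (intro continuous_intros) auto
  have eig: "\<mu> * f y = rn y * A y" and eig': "\<mu> * f y = (\<Sum>i=1..n. rn y * rn (x i) * k y (x i) * f (x i)) / real n"
    if y: "y \<in> S" for y
  proof -
    have "\<mu> * f y = (\<integral>w. normalized_kernel k Q y w * f w \<partial>Q)"
      using eigen[OF y] y by (simp add: normalized_operator_def Q_def gauss.space_P)
    also have "\<dots> = (\<Sum>i=1..n. normalized_kernel k Q y (x i) * f (x i)) / real n"
      unfolding Q_def
    proof (rule integral_empirical_measure[OF \<open>n \<ge> 1\<close> x'])
      have "continuous_on S (\<lambda>y. (\<Sum>i=1..n. k y (x i)) / real n)"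
        using k_col_cont \<open>n \<ge> 1\<close> by (intro continuous_intros) auto
      then have "continuous_on S dn"
        using dn_eq by (simp cong: continuous_on_cong)
      then have "continuous_on S (\<lambda>w. k y w / sqrt (dn y * dn w) * f w)"
        using y dn_pos
        by (intro continuous_intros f gauss.kernel_section_continuous) (auto dest: dn_pos)
      then show "(\<lambda>w. normalized_kernel k (empirical_measure P x n) y w * f w) \<in> borel_measurable P"
        unfolding normalized_kernel_def dn_def Q_def by (rule gauss.continuous_imp_measurable)
    qed
    also have "\<dots> = (\<Sum>i=1..n. rn y * rn (x i) * k y (x i) * f (x i)) / real n"
      by (simp add: normalized_kernel_def rn_def dn_def real_sqrt_mult)
    finally show 1: "\<mu> * f y = (\<Sum>i=1..n. rn y * rn (x i) * k y (x i) * f (x i)) / real n" .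
    then show "\<mu> * f y = rn y * A y"
      by (simp add: A_def a_def sum_distrib_left mult_ac)
  qed
  \<comment> \<open>The eigenvalue equation reads f = rn * A / \<mu>; here the random
    \<open>rn\<close> is replaced by the deterministic \<open>r\<close>. What remains random in g
    are the coefficients \<open>a i\<close> and centres \<open>x i\<close> of a finite combination
    of kernel sections, which linearity pulls out of the deviation.\<close>
  define g where "g y = r y * A y / \<mu>" for y
  have g_cont: "continuous_on S g"
    unfolding g_def using \<open>\<mu> \<noteq> 0\<close> by (intro continuous_intros r_cont A_cont) auto
  have f_g: "\<bar>f y - g y\<bar> \<le> q ^ 3 * e / m" if y: "y \<in> S" for y
  proof -
    have "f y = rn y * A y / \<mu>"
      using eig[OF y] \<open>\<mu> \<noteq> 0\<close> by (simp add: field_simps)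
    then have "f y - g y = (rn y - r y) * A y / \<mu>"
      by (simp add: g_def left_diff_distrib diff_divide_distrib)
    moreover have "\<bar>(rn y - r y) * A y\<bar> \<le> q\<^sup>2 * e * q"
      unfolding abs_mult using rn_r[OF y] A_bound[of y] q \<open>e \<ge> 0\<close> by (intro mult_mono) auto
    moreover have "q\<^sup>2 * e * q = q ^ 3 * e"
      by (simp add: power2_eq_square power3_eq_cube)
    ultimately show ?thesis
      using m q \<open>e \<ge> 0\<close> by (auto simp: abs_divide intro!: frac_le)
  qed
  define D where "D = deviation P x n"
  have int_hf: "integrable P (\<lambda>y. hf y * (f y - g y))" "integrable P (\<lambda>y. hf y * g y)"
    by (intro gauss.continuous_integrable continuous_intros hf_cont f g_cont)+
  have "normalized.integral_op f z = (\<integral>y. hf y * f y \<partial>P)"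
    unfolding normalized.integral_op_def using hf_eq
    by (intro Bochner_Integration.integral_cong) (auto simp: gauss.space_P)
  \<comment> \<open>The residual splits into a comparison of h with h_n on the sample
    (\<open>D3\<close>) and a deviation of h(z, .) f. The latter is treated with g in place of f
    (\<open>D2\<close>); the remainder f - g is already O(e), so the crude deviation bound serves
    (\<open>D1\<close>).\<close>
  then have T_eq: "normalized.integral_op f z = (\<Sum>i=1..n. hf (x i) * f (x i)) / real n - D (\<lambda>y. hf y * f y)"
    by (simp add: D_def deviation_def)
  have D_split: "D (\<lambda>y. hf y * f y) = D (\<lambda>y. hf y * (f y - g y)) + D (\<lambda>y. hf y * g y)"
    using deviation_add[OF int_hf, of x n] by (simp add: D_def right_diff_distrib)
  have D1: "\<bar>D (\<lambda>y. hf y * (f y - g y))\<bar> \<le> 2 * (q\<^sup>2 * (q ^ 3 * e / m))"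
    unfolding D_def
  proof (rule deviation_abs_le[OF _ _ x' \<open>n \<ge> 1\<close>])
    show "(\<lambda>y. hf y * (f y - g y)) \<in> borel_measurable P"
      by (intro gauss.continuous_imp_measurable continuous_intros hf_cont f g_cont)
    show "\<bar>hf y * (f y - g y)\<bar> \<le> q\<^sup>2 * (q ^ 3 * e / m)" if "y \<in> space P" for y
      unfolding abs_mult using that hf_bound f_g by (intro mult_mono) (auto simp: gauss.space_P)
  qed
  have D2: "\<bar>D (\<lambda>y. hf y * g y)\<bar> \<le> q\<^sup>2 / m * e"
  proof -
    have r2: "r y * r y = 1 / d y" if "y \<in> S" for y
      using d_bounds(1)[OF that] c_bounds by (simp add: r_def)
    let ?\<phi> = "\<lambda>i y. k z y * k y (x i) / d y"
    \<comment> \<open>One \<open>r y\<close> from \<open>hf\<close> and one from g combine to 1 / d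
      y, which yields the second class. The hypothesis \<open>e2\<close> holds for all w at once and
      may therefore be used at w = x i, although \<open>x i\<close> belongs to the sample that
      defines D.\<close>
    have "D (\<lambda>y. hf y * g y) = D (\<lambda>y. \<Sum>i=1..n. (r z / \<mu> / real n * a i) * ?\<phi> i y)"
    proof -
      have eq: "hf y * g y = (\<Sum>i=1..n. (r z / \<mu> / real n * a i) * ?\<phi> i y)" if "y \<in> S" for y
      proof -
        have "hf y * g y = (r z / \<mu>) * (k z y * (r y * r y)) * A y"
          by (simp add: hf_def g_def)
        then show ?thesis
          unfolding r2[OF that] A_def by (simp add: sum_distrib_left sum_divide_distrib mult_ac)
      qed
      have "(\<integral>y. hf y * g y \<partial>P) = (\<integral>y. (\<Sum>i=1..n. (r z / \<mu> / real n * a i) * ?\<phi> i y) \<partial>P)"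
        using eq by (intro Bochner_Integration.integral_cong) (auto simp: gauss.space_P)
      moreover have "(\<Sum>j=1..n. hf (x j) * g (x j)) = (\<Sum>j=1..n. (\<Sum>i=1..n. (r z / \<mu> / real n * a i) * ?\<phi> i (x j)))"
        using eq x by (intro sum.cong) auto
      ultimately show ?thesis unfolding D_def deviation_def by simp
    qed
    also have "\<dots> = (\<Sum>i=1..n. (r z / \<mu> / real n * a i) * D (?\<phi> i))"
      unfolding D_def
    proof (rule deviation_sum)
      fix i assume "i \<in> {1..n}"
      then have "x i \<in> S" using x by auto
      then show "integrable P (?\<phi> i)"
        unfolding gauss_kernel_commute[of _ _ "x i"] using z
        by (intro gauss.continuous_integrable continuous_intros gauss.kernel_section_continuous d_continuous)
           (auto dest: d_pos)
    qed
    also have "\<dots> = (r z / \<mu>) * ((\<Sum>i=1..n. a i * D (?\<phi> i)) / real n)"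
      by (simp add: sum_distrib_left sum_divide_distrib mult_ac)
    also have "\<bar>\<dots>\<bar> \<le> (q / m) * (q * e)"
      unfolding abs_mult[of "r z / \<mu>"]
    proof (rule mult_mono)
      show "\<bar>r z / \<mu>\<bar> \<le> q / m"
        unfolding abs_divide using r[OF z] q m by (intro frac_le) auto
      show "\<bar>(\<Sum>i=1..n. a i * D (?\<phi> i)) / real n\<bar> \<le> q * e"
      proof (rule avg_le)
        fix i assume i: "i \<in> {1..n}"
        then have "x i \<in> S" using x by auto
        then show "\<bar>a i * D (?\<phi> i)\<bar> \<le> q * e"
          unfolding abs_mult using a_bound[OF i] e2[OF z] q by (intro mult_mono) (auto simp: D_def)
      qed
    qed (use q m in auto)
    finally show ?thesis by (simp add: power2_eq_square)
  qed
  have D3: "\<bar>(\<Sum>i=1..n. hf (x i) * f (x i)) / real n - \<mu> * f z\<bar> \<le> 2 * (q ^ 3 * e)"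
  proof -
    have "(\<Sum>i=1..n. hf (x i) * f (x i)) / real n - \<mu> * f z =
        (\<Sum>i=1..n. (r z * r (x i) - rn z * rn (x i)) * k z (x i) * f (x i)) / real n"
      unfolding eig'[OF z] hf_def by (simp add: sum_subtractf diff_divide_distrib left_diff_distrib)
    also have "\<bar>\<dots>\<bar> \<le> 2 * (q ^ 3 * e)"
    proof (rule avg_le)
      fix i assume "i \<in> {1..n}"
      then have xi: "x i \<in> S" using x by auto
      have "rn z * rn (x i) - r z * r (x i) = (rn z - r z) * r (x i) + rn z * (rn (x i) - r (x i))"
        by (simp add: algebra_simps)
      also have "\<bar>\<dots>\<bar> \<le> q\<^sup>2 * e * q + q * (q\<^sup>2 * e)"
      proof (rule order.trans[OF abs_triangle_ineq add_mono])
        show "\<bar>(rn z - r z) * r (x i)\<bar> \<le> q\<^sup>2 * e * q"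
          unfolding abs_mult using rn_r[OF z] r[OF xi] q \<open>e \<ge> 0\<close> by (intro mult_mono) auto
        show "\<bar>rn z * (rn (x i) - r (x i))\<bar> \<le> q * (q\<^sup>2 * e)"
          unfolding abs_mult using rn_r[OF xi] rn[OF z] q \<open>e \<ge> 0\<close> by (intro mult_mono) auto
      qed
      also have "\<dots> = 2 * (q ^ 3 * e)"
        by (simp add: power2_eq_square power3_eq_cube)
      finally have 1: "\<bar>r z * r (x i) - rn z * rn (x i)\<bar> \<le> 2 * (q ^ 3 * e)"
        by (simp add: abs_minus_commute)
      have "\<bar>r z * r (x i) - rn z * rn (x i)\<bar> * \<bar>k z (x i)\<bar> * \<bar>f (x i)\<bar> \<le> 2 * (q ^ 3 * e) * 1 * 1"
        using 1 k_bounds f(2)[OF xi] q \<open>e \<ge> 0\<close> by (intro mult_mono) auto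
      then show "\<bar>(r z * r (x i) - rn z * rn (x i)) * k z (x i) * f (x i)\<bar> \<le> 2 * (q ^ 3 * e)"
        by (simp add: abs_mult)
    qed
    finally show ?thesis .
  qed
  have "\<bar>normalized.integral_op f z - \<mu> * f z\<bar> \<le>
      2 * (q ^ 3 * e) + (2 * (q\<^sup>2 * (q ^ 3 * e / m)) + q\<^sup>2 / m * e)"
    using T_eq D_split D1 D2 D3 by linarith
  also have "\<dots> = (2 / (c ^ 5 * m) + 2 / c ^ 3 + 1 / (c\<^sup>2 * m)) * e"
    using c_bounds(1) m(1) by (simp add: q_def field_simps power_divide)
  finally show ?thesis .
qed

end

text \<open>One envelope for both classes and all centres z, w, so that a single Markov bound later
  controls everything; C is chosen before n.\<close>

lemma (in gauss_operator) gauss_class_deviation_bound: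
  assumes "iid_sample M P X"
  shows "\<exists>C>0. \<forall>n\<ge>1. \<exists>W\<in>borel_measurable M.
    (\<forall>\<omega>\<in>space M. \<forall>z\<in>S. \<forall>w\<in>S.
       ennreal \<bar>deviation P (\<lambda>i. X i \<omega>) n (k z)\<bar> \<le> W \<omega> \<and>
       ennreal \<bar>deviation P (\<lambda>i. X i \<omega>) n (\<lambda>y. k z y * k y w / d y)\<bar> \<le> W \<omega>) \<and>
    (\<integral>\<^sup>+\<omega>. W \<omega> \<partial>M) \<le> ennreal (C / sqrt (real n))"
proof -
  interpret sample: bounded_iid_sample M P X R
    using assms gauss.id_borel_measurable norm_S
    by (auto simp: bounded_iid_sample_def bounded_iid_sample_axioms_def gauss.space_P)
  let ?D = "\<lambda>\<omega> n. deviation P (\<lambda>i. X i \<omega>) n"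
  \<comment> \<open>A product of two sections has exponent (2/\<sigma>^2)(z + w) \<bullet> y, and z
    + w has norm at most 2 R. The single section fits into the same ball.\<close>
  define r where "r = 4 / \<sigma>\<^sup>2 * R"
  define E where "E = exp (real DIM('a) * r * R)"
  define g1 where "g1 y = exp (- (norm y)\<^sup>2 / \<sigma>\<^sup>2)" for y :: 'a
  define g2 where "g2 y = g1 y * g1 y / d y" for y
  have r: "0 \<le> r" using sample.R_nonneg by (simp add: r_def)
  have "E > 0" by (simp add: E_def)
  have g1: "0 < g1 y" "g1 y \<le> 1" for y by (simp_all add: g1_def)
  have g1_cont: "continuous_on S g1"
    unfolding g1_def using \<sigma>_pos by (intro continuous_intros) auto
  have g2_cont: "continuous_on S g2"
    unfolding g2_def by (intro continuous_intros g1_cont d_continuous) (auto dest: d_pos)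
  have g2: "\<bar>g2 y\<bar> \<le> 1 / c" if "y \<in> S" for y
  proof -
    have "g1 y * g1 y \<le> 1 * 1" using g1[of y] by (intro mult_mono) auto
    then have "g1 y * g1 y / d y \<le> 1 / c"
      using d_bounds(1)[OF that] c_bounds(1) by (intro frac_le) auto
    moreover have "0 \<le> g1 y * g1 y / d y"
      using g1[of y] d_bounds(1)[OF that] c_bounds(1) by auto
    ultimately show ?thesis by (simp add: g2_def)
  qed
  have k1: "k z = (\<lambda>y. g1 z * (exp (((2 / \<sigma>\<^sup>2) *\<^sub>R z) \<bullet> y) * g1 y))" for z
    by (rule ext) (simp add: gauss_kernel_factor g1_def)
  have k2: "(\<lambda>y. k z y * k y w / d y) =
      (\<lambda>y. (g1 z * g1 w) * (exp (((2 / \<sigma>\<^sup>2) *\<^sub>R (z + w)) \<bullet> y) * g2 y))" for z w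
  proof
    fix y
    have "k z y * k y w / d y = k z y * k w y / d y"
      by (simp add: gauss_kernel_commute[of \<sigma> y w])
    then show "k z y * k y w / d y = (g1 z * g1 w) * (exp (((2 / \<sigma>\<^sup>2) *\<^sub>R (z + w)) \<bullet> y) * g2 y)"
      unfolding k1 g2_def by (simp add: scaleR_add_right inner_add_left distrib_left exp_add)
  qed
  have bound: "\<exists>W\<in>borel_measurable M.
    (\<forall>\<omega>\<in>space M. \<forall>z\<in>S. \<forall>w\<in>S.
       ennreal \<bar>?D \<omega> n (k z)\<bar> \<le> W \<omega> \<and> ennreal \<bar>?D \<omega> n (\<lambda>y. k z y * k y w / d y)\<bar> \<le> W \<omega>) \<and>
    (\<integral>\<^sup>+\<omega>. W \<omega> \<partial>M) \<le> ennreal (E * (1 + 1 / c) / sqrt (real n))" if n: "n \<ge> 1" for n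
  proof -
    obtain W1 where W1 [measurable]: "W1 \<in> borel_measurable M"
      and W1_bound: "\<And>\<omega> v. \<omega> \<in> space M \<Longrightarrow> norm v \<le> r \<Longrightarrow>
         ennreal \<bar>?D \<omega> n (\<lambda>z. exp (v \<bullet> z) * g1 z)\<bar> \<le> W1 \<omega>"
      and W1_int: "(\<integral>\<^sup>+\<omega>. W1 \<omega> \<partial>M) \<le> ennreal (E * 1 / sqrt (real n))"
      using sample.exp_class_deviation_bound[OF n r gauss.continuous_imp_measurable[OF g1_cont], of 1] g1
      by (fastforce simp: E_def less_imp_le)
    obtain W2 where W2 [measurable]: "W2 \<in> borel_measurable M"
      and W2_bound: "\<And>\<omega> v. \<omega> \<in> space M \<Longrightarrow> norm v \<le> r \<Longrightarrow>
         ennreal \<bar>?D \<omega> n (\<lambda>z. exp (v \<bullet> z) * g2 z)\<bar> \<le> W2 \<omega>"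
      and W2_int: "(\<integral>\<^sup>+\<omega>. W2 \<omega> \<partial>M) \<le> ennreal (E * (1 / c) / sqrt (real n))"
      using sample.exp_class_deviation_bound[OF n r gauss.continuous_imp_measurable[OF g2_cont], of "1 / c"] g2
      unfolding E_def gauss.space_P by blast
    show ?thesis
    proof (intro bexI conjI ballI)
      fix \<omega> z w assume \<omega>: "\<omega> \<in> space M" and zw: "z \<in> S" "w \<in> S"
      have damp: "ennreal \<bar>a * b\<bar> \<le> W" if "0 \<le> a" "a \<le> 1" "ennreal \<bar>b\<bar> \<le> W" for a b :: real and W
      proof -
        have "\<bar>a * b\<bar> \<le> \<bar>b\<bar>" using that by (simp add: abs_mult mult_left_le_one_le)
        then show ?thesis using that(3) by (meson ennreal_leI order.trans)
      qed
      have "norm ((2 / \<sigma>\<^sup>2) *\<^sub>R v) \<le> r" if "norm v \<le> 2 * R" for v :: 'a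
        using mult_left_mono[OF that, of "2 / \<sigma>\<^sup>2"] by (simp add: r_def)
      moreover have "norm z \<le> 2 * R" "norm (z + w) \<le> 2 * R"
        using norm_S[OF zw(1)] norm_S[OF zw(2)] norm_triangle_ineq[of z w] norm_ge_zero[of z] by linarith+
      ultimately have nz: "norm ((2 / \<sigma>\<^sup>2) *\<^sub>R z) \<le> r" and nzw: "norm ((2 / \<sigma>\<^sup>2) *\<^sub>R (z + w)) \<le> r"
        by blast+
      have "ennreal \<bar>?D \<omega> n (k z)\<bar> \<le> W1 \<omega>"
        unfolding k1[of z] deviation_mult_left using g1 W1_bound[OF \<omega> nz]
        by (intro damp) (auto intro: less_imp_le)
      then show "ennreal \<bar>?D \<omega> n (k z)\<bar> \<le> W1 \<omega> + W2 \<omega>"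
        by (rule order.trans) simp
      have "g1 z * g1 w \<le> 1"
        using g1 by (intro mult_le_one) (auto intro: less_imp_le)
      then have "ennreal \<bar>?D \<omega> n (\<lambda>y. k z y * k y w / d y)\<bar> \<le> W2 \<omega>"
        unfolding k2 deviation_mult_left using g1[of z] g1[of w] W2_bound[OF \<omega> nzw]
        by (intro damp) auto
      then show "ennreal \<bar>?D \<omega> n (\<lambda>y. k z y * k y w / d y)\<bar> \<le> W1 \<omega> + W2 \<omega>"
        by (rule order.trans) simp
    next
      have "(\<integral>\<^sup>+\<omega>. W1 \<omega> + W2 \<omega> \<partial>M) = (\<integral>\<^sup>+\<omega>. W1 \<omega> \<partial>M) + (\<integral>\<^sup>+\<omega>. W2 \<omega> \<partial>M)"
        by (intro nn_integral_add) auto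
      also have "\<dots> \<le> ennreal (E * 1 / sqrt (real n)) + ennreal (E * (1 / c) / sqrt (real n))"
        using W1_int W2_int by (rule add_mono)
      also have "\<dots> = ennreal (E * (1 + 1 / c) / sqrt (real n))"
        using \<open>E > 0\<close> c_bounds(1)
        by (subst ennreal_plus[symmetric]) (auto simp: distrib_left add_divide_distrib)
      finally show "(\<integral>\<^sup>+\<omega>. W1 \<omega> + W2 \<omega> \<partial>M) \<le> ennreal (E * (1 + 1 / c) / sqrt (real n))" .
    qed measurable
  qed
  show ?thesis
  proof (intro exI conjI allI impI)
    show "0 < E * (1 + 1 / c)"
      using \<open>E > 0\<close> c_bounds(1) by (intro mult_pos_pos add_pos_pos) auto
  qed (rule bound)
qed

section \<open>Almost sure convergence, sup norms and the rate\<close>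

text \<open>Eigenfunctions lie in the generalized eigenspace with exponent j = 1. Dimension 1 gives
  a spanning set with a single vector b; u is a nonzero multiple of b, so every other multiple of b
  is one of u.\<close>

lemma simple_eigenvalue_eigenfunction_unique:
  assumes "simple_eigenvalue V A l" "eigenfunction V A l u"
    and f: "f \<in> V" "A f = (\<lambda>x. l * f x)"
  shows "\<exists>c. f = (\<lambda>x. c * u x)"
proof -
  let ?G = "generalized_eigenspace V A l"
  have gen: "g \<in> ?G" if "g \<in> V" "A g = (\<lambda>x. l * g x)" for g
    unfolding generalized_eigenspace_def using that by (auto simp: zero_fun_def intro!: exI[of _ 1])
  obtain B where B: "?G \<subseteq> fun_vs.span B" "card B = fun_vs.dim ?G"
    using fun_vs.basis_exists by metis
  have "card B = 1"
    using assms(1) B(2) by (simp add: simple_eigenvalue_def algebraic_multiplicity_def)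
  then obtain b where "B = {b}"
    by (auto simp: card_1_singleton_iff)
  then have multiple: "\<exists>t. g = (\<lambda>x. t * b x)" if "g \<in> ?G" for g
    using B(1) that by (auto simp: fun_vs.span_singleton)
  have "u \<in> ?G" "u \<noteq> 0"
    using assms(2) gen by (auto simp: eigenfunction_def)
  then obtain s where s: "u = (\<lambda>x. s * b x)"
    using multiple by blast
  then have "s \<noteq> 0" using \<open>u \<noteq> 0\<close> by (auto simp: zero_fun_def)
  obtain t where "f = (\<lambda>x. t * b x)"
    using multiple[OF gen[OF f]] by blast
  then have "f = (\<lambda>x. (t / s) * u x)"
    using s \<open>s \<noteq> 0\<close> by auto
  then show ?thesis by blast
qed

section \<open>Sup norms over a compact set\<close>

lemma sup_norm_le_iff:
  assumes "compact S" "S \<noteq> {}" "continuous_on S f"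
  shows "sup_norm S f \<le> t \<longleftrightarrow> (\<forall>x\<in>S. \<bar>f x\<bar> \<le> t)"
proof -
  have "compact ((\<lambda>x. \<bar>f x\<bar>) ` S)"
    using assms by (intro compact_continuous_image continuous_intros)
  then have "bdd_above ((\<lambda>x. \<bar>f x\<bar>) ` S)"
    by (intro bounded_imp_bdd_above compact_imp_bounded)
  then show ?thesis
    unfolding sup_norm_def using assms(2) by (intro cSUP_le_iff) auto
qed

lemma sup_norm_attained:
  assumes "compact S" "S \<noteq> {}" "continuous_on S f"
  obtains x where "x \<in> S" "\<bar>f x\<bar> = sup_norm S f" "\<And>y. y \<in> S \<Longrightarrow> \<bar>f y\<bar> \<le> sup_norm S f"
proof -
  obtain x where x: "x \<in> S" "\<And>y. y \<in> S \<Longrightarrow> \<bar>f y\<bar> \<le> \<bar>f x\<bar>"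
    using continuous_attains_sup[OF assms(1,2), of "\<lambda>x. \<bar>f x\<bar>"] assms(3)
    by (auto intro: continuous_intros)
  then have "sup_norm S f = \<bar>f x\<bar>"
    unfolding sup_norm_def by (intro cSup_eq_maximum) auto
  with x show ?thesis using that by simp
qed

text \<open>By continuity the bound need only be tested on a countable dense subset of S, which
  turns an uncountable intersection of events into a countable one.\<close>

lemma sets_sup_norm_le:
  fixes F :: "'w \<Rightarrow> 'a::euclidean_space \<Rightarrow> real"
  assumes "compact S" "S \<noteq> {}"
    and cont: "\<And>\<omega>. \<omega> \<in> space M \<Longrightarrow> continuous_on S (F \<omega>)"
    and meas: "\<And>x. x \<in> S \<Longrightarrow> (\<lambda>\<omega>. F \<omega> x) \<in> borel_measurable M"
  shows "{\<omega> \<in> space M. sup_norm S (F \<omega>) \<le> t} \<in> sets M"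
proof -
  obtain T where T: "countable T" "T \<subseteq> S" "S \<subseteq> closure T"
    by (rule separable)
  have "(\<forall>x\<in>S. \<bar>F \<omega> x\<bar> \<le> t) \<longleftrightarrow> (\<forall>x\<in>T. \<bar>F \<omega> x\<bar> \<le> t)" if "\<omega> \<in> space M" for \<omega>
  proof
    assume *: "\<forall>x\<in>T. \<bar>F \<omega> x\<bar> \<le> t"
    have "closed (S \<inter> (\<lambda>x. \<bar>F \<omega> x\<bar>) -` {..t})"
      using assms(1) cont[OF that]
      by (intro continuous_closed_preimage continuous_intros compact_imp_closed) auto
    moreover have "T \<subseteq> S \<inter> (\<lambda>x. \<bar>F \<omega> x\<bar>) -` {..t}"
      using * T(2) by auto
    ultimately have "closure T \<subseteq> S \<inter> (\<lambda>x. \<bar>F \<omega> x\<bar>) -` {..t}"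
      by (rule closure_minimal[rotated])
    then show "\<forall>x\<in>S. \<bar>F \<omega> x\<bar> \<le> t" using T(3) by auto
  qed (use T(2) in auto)
  then have "{\<omega> \<in> space M. sup_norm S (F \<omega>) \<le> t} = {\<omega> \<in> space M. \<forall>x\<in>T. \<bar>F \<omega> x\<bar> \<le> t}"
    using sup_norm_le_iff[OF assms(1,2) cont] by auto
  also have "\<dots> \<in> sets M"
  proof (rule sets.sets_Collect_countable_All'[OF _ T(1)])
    show "{\<omega> \<in> space M. \<bar>F \<omega> x\<bar> \<le> t} \<in> sets M" if "x \<in> T" for x
    proof -
      have [measurable]: "(\<lambda>\<omega>. F \<omega> x) \<in> borel_measurable M"
        using meas T(2) that by auto
      show ?thesis by measurable
    qed
  qed
  finally show ?thesis .
qed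

text \<open>Dominated convergence for the indicators of the bad events.\<close>

lemma (in prob_space) AE_tendsto_imp_eventually_close:
  fixes Y :: "nat \<Rightarrow> 'a \<Rightarrow> real"
  assumes meas: "\<And>n. n \<ge> 1 \<Longrightarrow> Y n \<in> borel_measurable M"
    and lim: "AE \<omega> in M. (\<lambda>n. Y n \<omega>) \<longlonglongrightarrow> l" and "\<epsilon> > 0" "\<delta> > 0"
  shows "\<exists>N\<ge>1. \<forall>n\<ge>N. prob {\<omega> \<in> space M. \<bar>Y n \<omega> - l\<bar> > \<epsilon>} \<le> \<delta>"
proof -
  \<comment> \<open>The shift by \<open>Suc\<close> avoids index 0, where measurability of
    \<open>Y\<close> is not assumed.\<close>
  let ?B = "\<lambda>n. {\<omega> \<in> space M. \<bar>Y (Suc n) \<omega> - l\<bar> > \<epsilon>}"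
  have [measurable]: "Y (Suc n) \<in> borel_measurable M" for n
    using meas by simp
  have "(\<lambda>n. \<integral>\<omega>. indicator (?B n) \<omega> \<partial>M) \<longlonglongrightarrow> (\<integral>\<omega>. (0 :: real) \<partial>M)"
  proof (rule integral_dominated_convergence[where w = "\<lambda>_. 1"])
    show "AE \<omega> in M. (\<lambda>n. indicator (?B n) \<omega> :: real) \<longlonglongrightarrow> 0"
      using lim
    proof eventually_elim
      case (elim \<omega>)
      then have "(\<lambda>n. Y (Suc n) \<omega>) \<longlonglongrightarrow> l" by (rule LIMSEQ_Suc)
      then have "eventually (\<lambda>n. \<bar>Y (Suc n) \<omega> - l\<bar> < \<epsilon>) sequentially"
        using \<open>\<epsilon> > 0\<close> by (auto simp: tendsto_iff dist_real_def)
      then have "eventually (\<lambda>n. indicator (?B n) \<omega> = (0 :: real)) sequentially"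
        by eventually_elim (auto simp: indicator_def)
      then show ?case by (rule tendsto_eventually)
    qed
  qed (auto simp: indicator_def)
  then have "(\<lambda>n. prob (?B n)) \<longlonglongrightarrow> 0" by simp
  then have "eventually (\<lambda>n. prob (?B n) < \<delta>) sequentially"
    using \<open>\<delta> > 0\<close> by (rule order_tendstoD)
  then obtain N where N: "\<And>n. n \<ge> N \<Longrightarrow> prob (?B n) < \<delta>"
    by (auto simp: eventually_sequentially)
  have "prob {\<omega> \<in> space M. \<bar>Y n \<omega> - l\<bar> > \<epsilon>} \<le> \<delta>" if "n \<ge> Suc N" for n
    using N[of "n - 1"] that by (cases n) auto
  then show ?thesis by (intro exI[of _ "Suc N"]) auto
qed

lemma (in prob_space) prob_le_of_nn_integral_le:
  assumes [measurable]: "W \<in> borel_measurable M"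
    and W: "(\<integral>\<^sup>+\<omega>. W \<omega> \<partial>M) \<le> ennreal C" and "0 \<le> C" "0 < t"
  shows "prob {\<omega> \<in> space M. ennreal t \<le> W \<omega>} \<le> C / t"
proof -
  have "{\<omega> \<in> space M. ennreal t \<le> W \<omega>} \<subseteq> {\<omega> \<in> space M. 1 \<le> ennreal (1 / t) * W \<omega>}"
  proof (intro Collect_mono impI conjI; elim conjE)
    fix \<omega> assume "ennreal t \<le> W \<omega>"
    then have "ennreal (1 / t) * ennreal t \<le> ennreal (1 / t) * W \<omega>"
      by (intro mult_left_mono) auto
    then show "1 \<le> ennreal (1 / t) * W \<omega>"
      using \<open>0 < t\<close> by (simp add: ennreal_mult[symmetric])
  qed
  then have "emeasure M {\<omega> \<in> space M. ennreal t \<le> W \<omega>} \<le>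
      emeasure M {\<omega> \<in> space M. 1 \<le> ennreal (1 / t) * W \<omega>}"
    by (intro emeasure_mono) measurable
  also have "\<dots> \<le> ennreal (1 / t) * (\<integral>\<^sup>+\<omega>. W \<omega> * indicator (space M) \<omega> \<partial>M)"
    by (rule nn_integral_Markov_inequality) measurable
  also have "(\<integral>\<^sup>+\<omega>. W \<omega> * indicator (space M) \<omega> \<partial>M) = (\<integral>\<^sup>+\<omega>. W \<omega> \<partial>M)"
    by (intro nn_integral_cong) auto
  also have "ennreal (1 / t) * (\<integral>\<^sup>+\<omega>. W \<omega> \<partial>M) \<le> ennreal (1 / t) * ennreal C"
    using W by (intro mult_left_mono) auto
  also have "\<dots> = ennreal (C / t)"
    using assms(3,4) by (simp add: ennreal_mult[symmetric])
  finally show ?thesis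
    using assms(3,4) by (simp add: emeasure_eq_measure)
qed

theorem mainTheorem4:
  fixes S :: "(real ^ 'm) set"
    and \<sigma>\<^sub>0 :: real
    and P :: "(real ^ 'm) measure"
    and M :: "'w measure"
    and X :: "nat \<Rightarrow> 'w \<Rightarrow> real ^ 'm"
    and T :: "(real ^ 'm \<Rightarrow> real) \<Rightarrow> (real ^ 'm \<Rightarrow> real)"
    and Tn :: "nat \<Rightarrow> 'w \<Rightarrow> (real ^ 'm \<Rightarrow> real) \<Rightarrow> (real ^ 'm \<Rightarrow> real)"
    and lam :: real and u :: "real ^ 'm \<Rightarrow> real"
    and lamn :: "nat \<Rightarrow> 'w \<Rightarrow> real" and un :: "nat \<Rightarrow> 'w \<Rightarrow> (real ^ 'm \<Rightarrow> real)"
  defines "T \<equiv> normalized_operator (gauss_kernel \<sigma>\<^sub>0) P"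
    and "Tn \<equiv> (\<lambda>n \<omega>. normalized_operator (gauss_kernel \<sigma>\<^sub>0)
                        (empirical_measure P (\<lambda>i. X i \<omega>) n))"
  assumes "compact S" and "\<sigma>\<^sub>0 > 0"
    and "prob_space P" and "sets P = sets (restrict_space borel S)" and "measure_support P = S"
    and "prob_space M"
    and "prob_space.indep_vars M (\<lambda>_. P) X {1..}"
    and "\<And>i. i \<ge> 1 \<Longrightarrow> distr M P (X i) = P"
    and "lam \<noteq> 0"
    and "simple_eigenvalue (cont_funs S) T lam"
    and "eigenfunction (cont_funs S) T lam u" and "sup_norm S u = 1"
    and "\<And>n. n \<ge> 1 \<Longrightarrow> lamn n \<in> borel_measurable M"
    and "AE \<omega> in M. (\<lambda>n. lamn n \<omega>) \<longlonglongrightarrow> lam"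
    and "\<And>n x. n \<ge> 1 \<Longrightarrow> x \<in> S \<Longrightarrow> (\<lambda>\<omega>. un n \<omega> x) \<in> borel_measurable M"
    and "\<And>n \<omega>. n \<ge> 1 \<Longrightarrow> \<omega> \<in> space M \<Longrightarrow>
           eigenfunction (cont_funs S) (Tn n \<omega>) (lamn n \<omega>) (un n \<omega>) \<and> sup_norm S (un n \<omega>) = 1"
  shows "\<exists>a :: nat \<Rightarrow> 'w \<Rightarrow> real.
           (\<forall>n \<omega>. a n \<omega> \<in> {1, - 1}) \<and>
           (\<forall>n\<ge>1. a n \<in> borel_measurable M) \<and>
           (\<forall>\<delta>. 0 < \<delta> \<and> \<delta> < 1 \<longrightarrow>
              (\<exists>C>0. \<exists>n\<^sub>\<delta>::nat. \<forall>n\<ge>n\<^sub>\<delta>.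
                 measure M {\<omega> \<in> space M.
                   sup_norm S (\<lambda>x. a n \<omega> * un n \<omega> x - u x) \<le> C / sqrt (real n)} \<ge> 1 - \<delta>))"
proof -
  interpret M: prob_space M by fact
  obtain R where R: "\<And>x. x \<in> S \<Longrightarrow> norm x \<le> R"
    using compact_imp_bounded[OF \<open>compact S\<close>] by (auto simp: bounded_iff)
  interpret G: gauss_operator P S \<sigma>\<^sub>0 R
    unfolding gauss_operator_def gauss_operator_axioms_def
    using \<open>prob_space P\<close> \<open>compact S\<close> \<open>\<sigma>\<^sub>0 > 0\<close> \<open>sets P = sets (restrict_space borel S)\<close>
      \<open>measure_support P = S\<close> R by blast
  interpret sample: iid_sample M P X
    unfolding iid_sample_def iid_sample_axioms_def
    using \<open>prob_space M\<close> \<open>prob_space P\<close> \<open>prob_space.indep_vars M (\<lambda>_. P) X {1..}\<close>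
      \<open>\<And>i. i \<ge> 1 \<Longrightarrow> distr M P (X i) = P\<close> by blast
  note compact_S = \<open>compact S\<close> and S_nonempty = G.gauss.S_nonempty

  have u: "u \<in> cont_funs S" "T u = (\<lambda>x. lam * u x)"
    using \<open>eigenfunction (cont_funs S) T lam u\<close> by (auto simp: eigenfunction_def)
  then have u_cont: "continuous_on S u" by (simp add: cont_funs_def)
  obtain x\<^sub>0 where x\<^sub>0: "x\<^sub>0 \<in> S" "\<bar>u x\<^sub>0\<bar> = 1" and u_le: "\<And>y. y \<in> S \<Longrightarrow> \<bar>u y\<bar> \<le> 1"
    using sup_norm_attained[OF compact_S S_nonempty u_cont] \<open>sup_norm S u = 1\<close> by metis
  have T_eq: "T f x = G.normalized.integral_op f x" if "x \<in> S" for f x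
    using that by (simp add: T_def G.normalized_operator_eq)
  interpret E: simple_eigenpair P S "normalized_kernel (gauss_kernel \<sigma>\<^sub>0) P" lam u x\<^sub>0
  proof
    show "G.normalized.integral_op u x = lam * u x" if "x \<in> S" for x
      using fun_cong[OF u(2), of x] T_eq[OF that] by simp
    show "\<exists>c. \<forall>x\<in>S. f x = c * u x"
      if f: "continuous_on S f" and eig: "\<And>x. x \<in> S \<Longrightarrow> G.normalized.integral_op f x = lam * f x" for f
    proof -
      \<comment> \<open>Members of \<open>cont_funs S\<close> vanish off S, so f is first replaced
        by its extension by zero; the integrals over P do not change.\<close>
      define f' where "f' x = (if x \<in> S then f x else 0)" for x
      have "f' \<in> cont_funs S"
        using f by (simp add: cont_funs_def f'_def cong: continuous_on_cong)
      moreover have "T f' = (\<lambda>x. lam * f' x)"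
      proof
        fix x
        have "G.normalized.integral_op f' x = G.normalized.integral_op f x"
          unfolding G.normalized.integral_op_def
          by (intro Bochner_Integration.integral_cong) (auto simp: f'_def G.gauss.space_P)
        then show "T f' x = lam * f' x"
          using eig by (simp add: T_def G.normalized_operator_eq f'_def)
      qed
      ultimately obtain c where "f' = (\<lambda>x. c * u x)"
        using simple_eigenvalue_eigenfunction_unique[OF \<open>simple_eigenvalue (cont_funs S) T lam\<close>
            \<open>eigenfunction (cont_funs S) T lam u\<close>] by blast
      then have "\<forall>x\<in>S. f x = c * u x" by (auto simp: f'_def fun_eq_iff split: if_splits)
      then show ?thesis by blast
    qed
  qed (use \<open>lam \<noteq> 0\<close> u_cont u_le x\<^sub>0 in auto)
  obtain K \<epsilon> where "K > 0" "\<epsilon> > 0" and stability: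
    "\<And>f \<mu> \<eta> x. continuous_on S f \<Longrightarrow> (\<forall>x\<in>S. \<bar>f x\<bar> \<le> 1) \<Longrightarrow> (\<exists>x\<in>S. \<bar>f x\<bar> = 1) \<Longrightarrow>
       (\<forall>x\<in>S. \<bar>G.normalized.integral_op f x - \<mu> * f x\<bar> \<le> \<eta>) \<Longrightarrow> \<eta> \<le> \<epsilon> \<Longrightarrow> \<bar>\<mu> - lam\<bar> \<le> \<epsilon> \<Longrightarrow> x \<in> S \<Longrightarrow>
       \<bar>(if f x\<^sub>0 * u x\<^sub>0 \<ge> 0 then 1 else -1) * f x - u x\<bar> \<le> K * \<eta>"
    using E.approximate_eigenfunction_stability by (elim exE conjE) (erule meta_mp[rotated], blast)
  obtain C\<^sub>0 where "C\<^sub>0 > 0" and envelope: "\<And>n. n \<ge> 1 \<Longrightarrow> \<exists>W\<in>borel_measurable M.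
    (\<forall>\<omega>\<in>space M. \<forall>z\<in>S. \<forall>w\<in>S.
       ennreal \<bar>deviation P (\<lambda>i. X i \<omega>) n (G.k z)\<bar> \<le> W \<omega> \<and>
       ennreal \<bar>deviation P (\<lambda>i. X i \<omega>) n (\<lambda>y. G.k z y * G.k y w / G.d y)\<bar> \<le> W \<omega>) \<and>
    (\<integral>\<^sup>+\<omega>. W \<omega> \<partial>M) \<le> ennreal (C\<^sub>0 / sqrt (real n))"
    using G.gauss_class_deviation_bound[OF sample.iid_sample_axioms] by blast
  \<comment> \<open>Eigenvalues within m of \<open>lam\<close> have absolute value at least m, as
    the residual bound requires.\<close>
  define m where "m = \<bar>lam\<bar> / 2"
  have "m > 0" using \<open>lam \<noteq> 0\<close> by (simp add: m_def)
  define L where "L = 2 / (G.c ^ 5 * m) + 2 / G.c ^ 3 + 1 / (G.c\<^sup>2 * m)"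
  have "L > 0"
    unfolding L_def using G.c_bounds(1) \<open>m > 0\<close> by (intro add_pos_pos divide_pos_pos mult_pos_pos) auto
  define \<epsilon>' where "\<epsilon>' = min \<epsilon> m"
  have "\<epsilon>' > 0" using \<open>\<epsilon> > 0\<close> \<open>m > 0\<close> by (simp add: \<epsilon>'_def)
  \<comment> \<open>Comparing signs at one point only, instead of via \<open>\<integral> u\<^sub>n u dP\<close>, makes \<open>a n\<close> obviously measurable.\<close>
  define a where "a n \<omega> = (if un n \<omega> x\<^sub>0 * u x\<^sub>0 \<ge> 0 then 1 else - 1 :: real)" for n \<omega>

  have un_cont: "continuous_on S (un n \<omega>)" if "n \<ge> 1" "\<omega> \<in> space M" for n \<omega>
    using assms(18)[OF that] by (simp add: eigenfunction_def cont_funs_def)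
  have a_meas: "a n \<in> borel_measurable M" if "n \<ge> 1" for n
  proof -
    have [measurable]: "(\<lambda>\<omega>. un n \<omega> x\<^sub>0) \<in> borel_measurable M"
      using assms(17) that x\<^sub>0(1) by blast
    show ?thesis unfolding a_def by measurable
  qed
  \<comment> \<open>The deterministic core: for a fixed outcome, small deviations and a nearby
    eigenvalue already give the estimate, so probability remains only in bounding two bad
    events.\<close>
  have close: "\<bar>a n \<omega> * un n \<omega> x - u x\<bar> \<le> K * (L * e)"
    if n: "n \<ge> 1" and \<omega>: "\<omega> \<in> space M" and near: "\<bar>lamn n \<omega> - lam\<bar> \<le> \<epsilon>'" and "L * e \<le> \<epsilon>"
      and e1: "\<And>z. z \<in> S \<Longrightarrow> \<bar>deviation P (\<lambda>i. X i \<omega>) n (G.k z)\<bar> \<le> e"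
      and e2: "\<And>z w. z \<in> S \<Longrightarrow> w \<in> S \<Longrightarrow>
         \<bar>deviation P (\<lambda>i. X i \<omega>) n (\<lambda>y. G.k z y * G.k y w / G.d y)\<bar> \<le> e"
      and x: "x \<in> S" for n \<omega> e x
  proof -
    have eig: "eigenfunction (cont_funs S) (Tn n \<omega>) (lamn n \<omega>) (un n \<omega>)" and "sup_norm S (un n \<omega>) = 1"
      using assms(18)[OF n \<omega>] by auto
    then obtain y where y: "y \<in> S" "\<bar>un n \<omega> y\<bar> = 1" and le: "\<And>y. y \<in> S \<Longrightarrow> \<bar>un n \<omega> y\<bar> \<le> 1"
      using sup_norm_attained[OF compact_S S_nonempty un_cont[OF n \<omega>]] by metis
    have "\<bar>lamn n \<omega> - lam\<bar> \<le> m" using near by (simp add: \<epsilon>'_def)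
    then have "m \<le> \<bar>lamn n \<omega>\<bar>" unfolding m_def by linarith
    then have "\<bar>G.normalized.integral_op (un n \<omega>) z - lamn n \<omega> * un n \<omega> z\<bar> \<le> L * e" if "z \<in> S" for z
      unfolding L_def
    proof (intro G.empirical_eigenfunction_residual[OF n _ un_cont[OF n \<omega>] le _ \<open>m > 0\<close> _ e1 e2 that])
      show "X i \<omega> \<in> S" if "i \<ge> 1" for i
        using sample.X_in_space[OF that \<omega>] by (simp add: G.gauss.space_P)
      show "normalized_operator G.k (empirical_measure P (\<lambda>i. X i \<omega>) n) (un n \<omega>) z = lamn n \<omega> * un n \<omega> z" for z
        using eig fun_cong[of "Tn n \<omega> (un n \<omega>)" _ z] by (simp add: eigenfunction_def Tn_def)
    qed
    then show ?thesis
      unfolding a_def using y le near \<open>L * e \<le> \<epsilon>\<close> x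
      by (intro stability un_cont[OF n \<omega>]) (auto simp: \<epsilon>'_def)
  qed

  have "\<exists>C>0. \<exists>n\<^sub>\<delta>::nat. \<forall>n\<ge>n\<^sub>\<delta>.
     measure M {\<omega> \<in> space M. sup_norm S (\<lambda>x. a n \<omega> * un n \<omega> x - u x) \<le> C / sqrt (real n)} \<ge> 1 - \<delta>"
    if "0 < \<delta>" for \<delta>
  proof -
    \<comment> \<open>Markov's inequality at level A / sqrt n bounds the deviation event by
      \<open>C\<^sub>0\<close> / A = \<delta>/2; the eigenvalue event takes the other
      \<delta>/2.\<close>
    define A where "A = 2 * C\<^sub>0 / \<delta>"
    have "A > 0" using \<open>C\<^sub>0 > 0\<close> \<open>0 < \<delta>\<close> by (simp add: A_def)
    have "\<delta> / 2 > 0" using \<open>0 < \<delta>\<close> by simp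
    from M.AE_tendsto_imp_eventually_close[OF assms(15,16) \<open>\<epsilon>' > 0\<close> this]
    obtain N1 where "N1 \<ge> 1" and N1: "\<And>n. n \<ge> N1 \<Longrightarrow> M.prob {\<omega> \<in> space M. \<bar>lamn n \<omega> - lam\<bar> > \<epsilon>'} \<le> \<delta> / 2"
      by blast
    \<comment> \<open>From \<open>N2\<close> on, the residual bound \<open>L * t\<close> lies within
      the stability radius \<epsilon>.\<close>
    obtain N2 :: nat where N2: "(L * A / \<epsilon>)\<^sup>2 \<le> real N2"
      using real_arch_simple by blast
    have "1 - \<delta> \<le> M.prob {\<omega> \<in> space M. sup_norm S (\<lambda>x. a n \<omega> * un n \<omega> x - u x) \<le> K * L * A / sqrt (real n)}"
      (is "_ \<le> M.prob ?good") if "n \<ge> max N1 N2" for n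
    proof -
      have n: "n \<ge> 1" "n \<ge> N1" "n \<ge> N2" using that \<open>N1 \<ge> 1\<close> by auto
      have sq: "sqrt (real n) > 0" using n by simp
      define t where "t = A / sqrt (real n)"
      have "t > 0" using \<open>A > 0\<close> sq by (simp add: t_def)
      have "L * t \<le> \<epsilon>"
      proof -
        have "L * A / \<epsilon> \<le> sqrt (real n)"
          using N2 n(3) by (intro real_le_rsqrt) linarith
        then show ?thesis using sq \<open>\<epsilon> > 0\<close> by (simp add: t_def field_simps)
      qed
      obtain W where [measurable]: "W \<in> borel_measurable M"
        and W: "\<And>\<omega> z w. \<omega> \<in> space M \<Longrightarrow> z \<in> S \<Longrightarrow> w \<in> S \<Longrightarrow>
           ennreal \<bar>deviation P (\<lambda>i. X i \<omega>) n (G.k z)\<bar> \<le> W \<omega> \<and>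
           ennreal \<bar>deviation P (\<lambda>i. X i \<omega>) n (\<lambda>y. G.k z y * G.k y w / G.d y)\<bar> \<le> W \<omega>"
        and int_W: "(\<integral>\<^sup>+\<omega>. W \<omega> \<partial>M) \<le> ennreal (C\<^sub>0 / sqrt (real n))"
        using envelope[OF n(1)] by blast
      have [measurable]: "lamn n \<in> borel_measurable M" using assms(15) n(1) by blast
      define B1 where "B1 = {\<omega> \<in> space M. \<bar>lamn n \<omega> - lam\<bar> > \<epsilon>'}"
      define B2 where "B2 = {\<omega> \<in> space M. ennreal t \<le> W \<omega>}"
      have [measurable]: "B1 \<in> sets M" "B2 \<in> sets M"
        unfolding B1_def B2_def by measurable
      have "M.prob B1 \<le> \<delta> / 2"
        unfolding B1_def by (rule N1[OF n(2)])
      moreover have "M.prob B2 \<le> \<delta> / 2"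
      proof -
        have "M.prob B2 \<le> C\<^sub>0 / sqrt (real n) / t"
          unfolding B2_def using \<open>C\<^sub>0 > 0\<close> \<open>t > 0\<close> int_W by (intro M.prob_le_of_nn_integral_le) auto
        also have "\<dots> = \<delta> / 2"
          using sq \<open>C\<^sub>0 > 0\<close> \<open>0 < \<delta>\<close> by (simp add: t_def A_def)
        finally show ?thesis .
      qed
      moreover have "M.prob (B1 \<union> B2) \<le> M.prob B1 + M.prob B2"
        by (rule measure_Un_le) auto
      ultimately have "M.prob (B1 \<union> B2) \<le> \<delta>" by linarith
      then have "1 - \<delta> \<le> M.prob (space M - (B1 \<union> B2))"
        by (subst M.prob_compl) auto
      also have "\<dots> \<le> M.prob ?good"
      proof (rule M.finite_measure_mono)
        have aun_cont: "continuous_on S (\<lambda>x. a n \<omega> * un n \<omega> x - u x)" if "\<omega> \<in> space M" for \<omega>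
          by (intro continuous_intros un_cont n that u_cont)
        show "?good \<in> sets M"
        proof (rule sets_sup_norm_le[OF compact_S S_nonempty aun_cont])
          fix x assume "x \<in> S"
          with n(1) have [measurable]: "(\<lambda>\<omega>. un n \<omega> x) \<in> borel_measurable M" "a n \<in> borel_measurable M"
            using assms(17) a_meas by auto
          show "(\<lambda>\<omega>. a n \<omega> * un n \<omega> x - u x) \<in> borel_measurable M" by measurable
        qed
        show "space M - (B1 \<union> B2) \<subseteq> ?good"
        proof
          fix \<omega> assume "\<omega> \<in> space M - (B1 \<union> B2)"
          then have \<omega>: "\<omega> \<in> space M" and near: "\<bar>lamn n \<omega> - lam\<bar> \<le> \<epsilon>'" and small: "W \<omega> < ennreal t"
            by (auto simp: B1_def B2_def not_less not_le)
          have dev: "b \<le> t" if "ennreal b \<le> W \<omega>" for b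
            using le_less_trans[OF that small] by (metis ennreal_leI linorder_not_le order_less_imp_le)
          have "\<bar>a n \<omega> * un n \<omega> x - u x\<bar> \<le> K * (L * t)" if "x \<in> S" for x
            \<comment> \<open>For the one-argument class \<open>W\<close> still asks for a second
              point of S; \<open>x\<^sub>0\<close> fills that slot.\<close>
            using W[OF \<omega>] x\<^sub>0(1)
            by (intro close[OF n(1) \<omega> near \<open>L * t \<le> \<epsilon>\<close> _ _ that] dev) auto
          then have "sup_norm S (\<lambda>x. a n \<omega> * un n \<omega> x - u x) \<le> K * L * A / sqrt (real n)"
            unfolding sup_norm_le_iff[OF compact_S S_nonempty aun_cont[OF \<omega>]]
            by (simp add: t_def mult.assoc)
          with \<omega> show "\<omega> \<in> ?good" by simp
        qed
      qed
      finally show ?thesis .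
    qed
    moreover have "K * L * A > 0" using \<open>K > 0\<close> \<open>L > 0\<close> \<open>A > 0\<close> by simp
    ultimately show ?thesis by blast
  qed
  then show ?thesis
    using a_meas by (intro exI[of _ a]) (auto simp: a_def)
qed

end
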